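(* If $X$ is a finite graph, then $NC^*(X)$ is locally connected.
   Context: A continuum is a compact connected metric space with more than one point; a subcontinuum of $X$ is a nonempty closed connected subset of $X$ (one-point sets are allowed). An arc is a space homeomorphic to $[0,1]$. A finite graph is a continuum that can be written as the union of finitely many arcs, any two of which can intersect in at most one or both of their end points. $C(X)$ is the set of all subcontinua of $X$, endowed with the Hausdorff metric (equivalently, the Vietoris topology), and $NC^*(X)=\{A\in C(X): X\setminus A \text{ is connected}\}$ with the subspace topology; the empty set counts as connected, so $X\in NC^*(X)$. *)

theory Defs
  imports "HOL-Analysis.Analysis"
begin

text \<open>
  Spaces are subsets X of a type of class \<^class>\<open>metric_space\<close>, with the restricted metric.
\<close>

definition continuum :: "'a::metric_space set \<Rightarrow> bool" where
  "continuum X \<longleftrightarrow> compact X \<and> connected X \<and> (\<exists>x\<in>X. \<exists>y\<in>X. x \<noteq> y)"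

definition is_arc :: "'a::metric_space set \<Rightarrow> bool" where
  "is_arc A \<longleftrightarrow> A homeomorphic {0..1::real}"

text \<open>
  The pair of end points does not depend on the parametrization, since a homeomorphism of the unit
  interval onto itself permutes 0 and 1.
\<close>

definition arc_endpoints :: "'a::metric_space set \<Rightarrow> 'a set" where
  "arc_endpoints A = {p. \<exists>f g. homeomorphism {0..1::real} A f g \<and> (p = f 0 \<or> p = f 1)}"

text \<open>
  A point shared by two of the arcs has to be an end point of both.
\<close>

definition finite_graph :: "'a::metric_space set \<Rightarrow> bool" where
  "finite_graph X \<longleftrightarrow> continuum X \<and>
     (\<exists>\<A>. finite \<A> \<and> (\<forall>A\<in>\<A>. is_arc A) \<and> X = \<Union>\<A> \<and>
          (\<forall>A\<in>\<A>. \<forall>B\<in>\<A>. A \<noteq> B \<longrightarrow> A \<inter> B \<subseteq> arc_endpoints A \<inter> arc_endpoints B))"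

definition subcontinua :: "'a::metric_space set \<Rightarrow> 'a set set" where
  "subcontinua X = {A. A \<noteq> {} \<and> closedin (top_of_set X) A \<and> connected A}"

text \<open>
  The value 0 outside the bounded nonempty sets is only a convention: the locale
  \<^locale>\<open>Metric_space\<close> asks for nonnegativity on the whole type, and the infimum of the empty set is
  unspecified.
\<close>

definition hausdorff_dist :: "'a::metric_space set \<Rightarrow> 'a set \<Rightarrow> real" where
  "hausdorff_dist A B =
     (if A \<noteq> {} \<and> B \<noteq> {} \<and> bounded A \<and> bounded B
      then Inf {e. 0 < e \<and> A \<subseteq> (\<Union>b\<in>B. ball b e) \<and> B \<subseteq> (\<Union>a\<in>A. ball a e)}
      else 0)"

definition subcontinua_topology :: "'a::metric_space set \<Rightarrow> 'a set topology" where
  "subcontinua_topology X = Metric_space.mtopology (subcontinua X) hausdorff_dist"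

definition NC_star :: "'a::metric_space set \<Rightarrow> 'a set set" where
  "NC_star X = {A \<in> subcontinua X. connected (X - A)}"

lemma hausdorff_dist_witness:
  fixes A B :: "'a::metric_space set"
  assumes "A \<noteq> {}" "B \<noteq> {}" "bounded A" "bounded B"
  shows "\<exists>e>0. A \<subseteq> (\<Union>b\<in>B. ball b e) \<and> B \<subseteq> (\<Union>a\<in>A. ball a e)"
proof -
  have "bounded (A \<union> B)" using assms by simp
  then obtain e where e: "\<And>x y. x \<in> A \<union> B \<Longrightarrow> y \<in> A \<union> B \<Longrightarrow> dist x y \<le> e"
    unfolding bounded_two_points by blast
  obtain a b where "a \<in> A" "b \<in> B" using assms by blast
  then have e': "0 \<le> e" using order_trans[OF zero_le_dist[of a b] e[of a b]] by simp
  have "A \<subseteq> (\<Union>b\<in>B. ball b (e + 1))"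
  proof
    fix x assume "x \<in> A"
    then have "dist b x < e + 1" using e[of b x] \<open>b \<in> B\<close> by simp
    then show "x \<in> (\<Union>b\<in>B. ball b (e + 1))" using \<open>b \<in> B\<close> by auto
  qed
  moreover have "B \<subseteq> (\<Union>a\<in>A. ball a (e + 1))"
  proof
    fix x assume "x \<in> B"
    then have "dist a x < e + 1" using e[of a x] \<open>a \<in> A\<close> by simp
    then show "x \<in> (\<Union>a\<in>A. ball a (e + 1))" using \<open>a \<in> A\<close> by auto
  qed
  ultimately show ?thesis using e' by (intro exI[of _ "e + 1"]) auto
qed

lemma hausdorff_dist_less_iff:
  fixes A B :: "'a::metric_space set"
  assumes "A \<noteq> {}" "B \<noteq> {}" "bounded A" "bounded B"
  shows "hausdorff_dist A B < r \<longleftrightarrow>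
    (\<exists>e. 0 < e \<and> e < r \<and> A \<subseteq> (\<Union>b\<in>B. ball b e) \<and> B \<subseteq> (\<Union>a\<in>A. ball a e))"
proof -
  let ?E = "{e. 0 < e \<and> A \<subseteq> (\<Union>b\<in>B. ball b e) \<and> B \<subseteq> (\<Union>a\<in>A. ball a e)}"
  have "?E \<noteq> {}" using hausdorff_dist_witness[OF assms] by blast
  moreover have "bdd_below ?E" by (rule bdd_belowI[of _ 0]) auto
  ultimately have "Inf ?E < r \<longleftrightarrow> (\<exists>e\<in>?E. e < r)" by (rule cInf_less_iff)
  then show ?thesis using assms by (auto simp: hausdorff_dist_def)
qed

lemma hausdorff_dist_nonneg: "0 \<le> hausdorff_dist A B"
proof (cases "A \<noteq> {} \<and> B \<noteq> {} \<and> bounded A \<and> bounded B")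
  case True
  then show ?thesis using hausdorff_dist_less_iff[of A B 0] by force
qed (auto simp: hausdorff_dist_def)

lemma hausdorff_dist_commute: "hausdorff_dist A B = hausdorff_dist B A"
  unfolding hausdorff_dist_def by (simp add: conj_commute conj_left_commute)

lemma hausdorff_dist_subset_closure:
  assumes "A \<noteq> {}" "B \<noteq> {}" "bounded A" "bounded B" "hausdorff_dist A B = 0"
  shows "A \<subseteq> closure B"
proof
  fix x assume "x \<in> A"
  show "x \<in> closure B"
    unfolding closure_approachable
  proof (intro allI impI)
    fix r :: real assume "0 < r"
    then obtain e where "e < r" "A \<subseteq> (\<Union>b\<in>B. ball b e)"
      using hausdorff_dist_less_iff[of A B r] assms by auto
    moreover from this(2) \<open>x \<in> A\<close> obtain b where "b \<in> B" "dist b x < e" by auto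
    ultimately show "\<exists>y\<in>B. dist y x < r" by force
  qed
qed

lemma UN_ball_trans:
  fixes A B C :: "'a::metric_space set"
  assumes "A \<subseteq> (\<Union>b\<in>B. ball b e)" "B \<subseteq> (\<Union>c\<in>C. ball c e')"
  shows "A \<subseteq> (\<Union>c\<in>C. ball c (e + e'))"
proof
  fix x assume "x \<in> A"
  then obtain b where b: "b \<in> B" "dist b x < e" using assms(1) by auto
  then obtain c where c: "c \<in> C" "dist c b < e'" using assms(2) by auto
  have "dist c x < e + e'" using b c dist_triangle[of c x b] by linarith
  with c show "x \<in> (\<Union>c\<in>C. ball c (e + e'))" by auto
qed

lemma hausdorff_dist_triangle:
  fixes A B C :: "'a::metric_space set"
  assumes "A \<noteq> {}" "B \<noteq> {}" "C \<noteq> {}" "bounded A" "bounded B" "bounded C"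
  shows "hausdorff_dist A C \<le> hausdorff_dist A B + hausdorff_dist B C"
proof (rule field_le_epsilon)
  fix r :: real assume "0 < r"
  obtain e where e: "0 < e" "e < hausdorff_dist A B + r / 2"
      "A \<subseteq> (\<Union>b\<in>B. ball b e)" "B \<subseteq> (\<Union>a\<in>A. ball a e)"
    using hausdorff_dist_less_iff[THEN iffD1, OF assms(1,2,4,5), of "hausdorff_dist A B + r / 2"]
      \<open>0 < r\<close> by (elim exE conjE meta_impE) simp_all
  obtain e' where e': "0 < e'" "e' < hausdorff_dist B C + r / 2"
      "B \<subseteq> (\<Union>c\<in>C. ball c e')" "C \<subseteq> (\<Union>b\<in>B. ball b e')"
    using hausdorff_dist_less_iff[THEN iffD1, OF assms(2,3,5,6), of "hausdorff_dist B C + r / 2"]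
      \<open>0 < r\<close> by (elim exE conjE meta_impE) simp_all
  have "A \<subseteq> (\<Union>c\<in>C. ball c (e + e'))" by (rule UN_ball_trans[OF e(3) e'(3)])
  moreover have "C \<subseteq> (\<Union>a\<in>A. ball a (e + e'))"
    using UN_ball_trans[OF e'(4) e(4)] by (simp add: add.commute)
  moreover have "e + e' < hausdorff_dist A B + hausdorff_dist B C + r" using e e' by linarith
  ultimately have "hausdorff_dist A C < hausdorff_dist A B + hausdorff_dist B C + r"
    using add_pos_pos[OF e(1) e'(1)]
    by (intro hausdorff_dist_less_iff[THEN iffD2, OF assms(1,3,4,6)] exI[of _ "e + e'"] conjI)
  then show "hausdorff_dist A C \<le> hausdorff_dist A B + hausdorff_dist B C + r" by simp
qed

lemma subcontinua_compact:
  assumes "compact X" "A \<in> subcontinua X"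
  shows "compact A" "A \<noteq> {}"
  using assms closedin_compact by (auto simp: subcontinua_def)

lemma Metric_space_subcontinua:
  assumes "compact X"
  shows "Metric_space (subcontinua X) hausdorff_dist"
proof
  fix A B :: "'a set"
  show "0 \<le> hausdorff_dist A B" by (rule hausdorff_dist_nonneg)
  show "hausdorff_dist A B = hausdorff_dist B A" by (rule hausdorff_dist_commute)
next
  fix A B assume A: "A \<in> subcontinua X" and B: "B \<in> subcontinua X"
  note cA = subcontinua_compact[OF assms A] and cB = subcontinua_compact[OF assms B]
  have bnd: "bounded A" "bounded B" using cA cB compact_imp_bounded by auto
  show "hausdorff_dist A B = 0 \<longleftrightarrow> A = B"
  proof
    assume "hausdorff_dist A B = 0"
    then have "A \<subseteq> closure B" "B \<subseteq> closure A"
      using hausdorff_dist_subset_closure[of A B] hausdorff_dist_subset_closure[of B A] cA cB bnd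
      by (simp_all add: hausdorff_dist_commute[of B A])
    then show "A = B" using cA cB by (simp add: compact_imp_closed)
  next
    assume "A = B"
    have "hausdorff_dist A A < r" if "0 < r" for r
    proof -
      have "A \<subseteq> (\<Union>a\<in>A. ball a (r/2))" using that by force
      then show ?thesis using that cA bnd
        unfolding hausdorff_dist_less_iff[OF cA(2) cA(2) bnd(1) bnd(1)]
        by (intro exI[of _ "r/2"]) auto
    qed
    then have "\<not> 0 < hausdorff_dist A A" by blast
    then show "hausdorff_dist A B = 0"
      using hausdorff_dist_nonneg[of A A] \<open>A = B\<close> by simp
  qed
next
  fix A B C
  assume A: "A \<in> subcontinua X" and B: "B \<in> subcontinua X" and C: "C \<in> subcontinua X"
  note cA = subcontinua_compact[OF assms A] and cB = subcontinua_compact[OF assms B]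
    and cC = subcontinua_compact[OF assms C]
  show "hausdorff_dist A C \<le> hausdorff_dist A B + hausdorff_dist B C"
    using cA cB cC by (intro hausdorff_dist_triangle) (auto simp: compact_imp_bounded)
qed

end

theory Submission
  imports Defs
begin

text \<open>
  Let A be a subcontinuum of X with connected complement. It is enough to join every nearby
  subcontinuum B of the same kind to A by a connected family of small members of NC*(X): this is
  connectedness im kleinen at every point, and a space with that property is locally connected.

  The graph enters through its stars: every point p has arbitrarily small closed neighbourhoods that
  consist of finitely many legs, arcs starting at p and disjoint apart from p and possibly their
  outer ends. Since A is connected, a sufficiently short leg is, apart from p, either contained in A
  or disjoint from A (\<open>leg_eventually_homogeneous\<close>). By compactness, the frontier of A in X is then
  a finite set P, and the points of P have disjoint stars of this kind.

  Moving the point with parameter s on each leg to the parameter s powr u defines, for each u > 0, a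
  homeomorphism \<open>flow\<close> of X onto itself. It maps NC*(X) to itself, it fixes A because every leg is
  preserved, and for u tending to infinity it contracts the part of each star with parameter below a
  given c < 1 to the centre. So if A and B differ only in such parts of the stars at P, and B meets
  each of them, then the images of B under the flow converge to A in the Hausdorff metric; the orbit
  for u \<ge> 1 together with its limit A is the required connected set (\<open>flow_orbit_connected\<close>).

  What remains is that every B in NC*(X) near A has this form (\<open>NC_star_nearby\<close>). Off the stars at P,
  being close to A keeps B out of the complement of A. Conversely, B meets every leg of finitely many
  small stars inside A. If B missed a point of A off the stars at P, its points on the legs would
  separate the inner part of one of these small stars from the rest of X, so that the connected set
  X - B would lie inside that star (\<open>star_barrier\<close>). For A different from X this is impossible, as
  X - B also contains a point outside A. For A = X it means that A and B differ only in that one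
  star, which then takes the place of the stars at P.
\<close>

section \<open>Stars\<close>

text \<open>
  A star is given by the parametrizations of its legs. Two legs may end in the same point: in a
  multigraph the full edges at a vertex form a star in this sense.
\<close>

definition star_at :: "'a::metric_space set \<Rightarrow> 'a \<Rightarrow> (real \<Rightarrow> 'a) set \<Rightarrow> bool" where
  "star_at X q G \<longleftrightarrow> finite G \<and> q \<in> X \<and>
     (\<forall>g\<in>G. continuous_on {0..1} g \<and> inj_on g {0..1} \<and> g ` {0..1} \<subseteq> X \<and> g 0 = q) \<and>
     (\<forall>g\<in>G. \<forall>h\<in>G. g \<noteq> h \<longrightarrow> g ` {0<..<1} \<inter> h ` {0..1} = {}) \<and>
     openin (top_of_set X) (insert q (\<Union>g\<in>G. g ` {0..<1}))"

definition open_star :: "'a \<Rightarrow> (real \<Rightarrow> 'a) set \<Rightarrow> real \<Rightarrow> 'a set" where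
  "open_star q G c = insert q (\<Union>g\<in>G. g ` {0..<c})"

lemma star_at_leg:
  assumes "star_at X q G" "g \<in> G"
  shows "continuous_on {0..1} g" "inj_on g {0..1}" "g ` {0..1} \<subseteq> X" "g 0 = q"
  using assms by (auto simp: star_at_def)

lemma star_at_disjoint:
  assumes "star_at X q G" "g \<in> G" "h \<in> G" "g \<noteq> h"
  shows "g ` {0<..<1} \<inter> h ` {0..1} = {}"
  using assms by (simp add: star_at_def)

lemma star_at_unique:
  assumes "star_at X q G" "g \<in> G" "h \<in> G" "s \<in> {0..1}" "t \<in> {0<..<1}" "g s = h t"
  shows "g = h \<and> s = t"
proof -
  have "g = h" 
  proof (rule ccontr)
    assume "g \<noteq> h"
    then have "h ` {0<..<1} \<inter> g ` {0..1} = {}" using star_at_disjoint[OF assms(1,3,2)] by simp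
    moreover have "g s \<in> h ` {0<..<1}" using assms(5,6) by simp
    moreover have "g s \<in> g ` {0..1}" using assms(4) by simp
    ultimately show False by blast
  qed
  moreover have "s = t" if "g = h"
    using inj_onD[OF star_at_leg(2)[OF assms(1,3)], of s t] assms(4-6) that by simp
  ultimately show ?thesis by blast
qed

lemma star_at_center:
  assumes "star_at X q G" "g \<in> G" "t \<in> {0<..1}"
  shows "g t \<noteq> q"
  using star_at_leg(2,4)[OF assms(1,2)] assms(3) inj_onD[of g "{0..1}" 0 t] by auto

lemma compact_leg:
  assumes "star_at X q G" "g \<in> G" "0 \<le> a" "b \<le> 1"
  shows "compact (g ` {a..b})"
  by (rule compact_continuous_image[OF continuous_on_subset[OF star_at_leg(1)[OF assms(1,2)]]])
    (use assms(3,4) in auto)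

lemma openin_minus_compact:
  fixes X K :: "'a::metric_space set"
  assumes "openin (top_of_set X) U" "compact K"
  shows "openin (top_of_set X) (U - K)"
proof -
  have "closedin (top_of_set X) (X \<inter> K)"
    using assms(2) by (simp add: closedin_closed_Int compact_imp_closed)
  then have "openin (top_of_set X) (U - X \<inter> K)" by (rule openin_diff[OF assms(1)])
  moreover have "U - X \<inter> K = U - K" using openin_imp_subset[OF assms(1)] by blast
  ultimately show ?thesis by simp
qed

text \<open>
  The points removed from the full open star to obtain the truncated one form a compact set,
  because there are only finitely many legs.
\<close>

lemma openin_truncated_star:
  assumes st: "star_at X q G" and r: "\<And>g. g \<in> G \<Longrightarrow> 0 < r g \<and> r g \<le> 1"
  shows "openin (top_of_set X) (insert q (\<Union>g\<in>G. g ` {0..<r g}))"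
proof -
  have "insert q (\<Union>g\<in>G. g ` {0..<r g}) = insert q (\<Union>g\<in>G. g ` {0..<1}) - (\<Union>g\<in>G. g ` {r g..1})"
    (is "?L = ?R")
  proof
    show "?L \<subseteq> ?R"
    proof
      fix x assume x: "x \<in> ?L"
      have False if gt: "g \<in> G" "t \<in> {r g..1}" "x = g t" for g t
      proof -
        have "x \<noteq> q" using star_at_center[OF st gt(1)] gt r[OF gt(1)] by auto
        then obtain h s where h: "h \<in> G" "s \<in> {0..<r h}" "x = h s" using x by auto
        then have "s \<noteq> 0" using \<open>x \<noteq> q\<close> star_at_leg(4)[OF st h(1)] by auto
        then have "g = h \<and> t = s"
          using star_at_unique[OF st gt(1) h(1), of t s] gt h r[OF gt(1)] r[OF h(1)] by auto
        then show False using gt h by auto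
      qed
      moreover have "x \<in> insert q (\<Union>g\<in>G. g ` {0..<1})" using x r by force
      ultimately show "x \<in> ?R" by blast
    qed
    show "?R \<subseteq> ?L" by force
  qed
  moreover have "openin (top_of_set X) (insert q (\<Union>g\<in>G. g ` {0..<1}))" "finite G"
    using st by (auto simp: star_at_def)
  ultimately show ?thesis
    using compact_leg[OF st] r by (auto intro!: openin_minus_compact compact_UN simp: less_imp_le)
qed

lemma openin_open_star:
  assumes "star_at X q G" "0 < c" "c \<le> 1"
  shows "openin (top_of_set X) (open_star q G c)"
  using openin_truncated_star[OF assms(1), of "\<lambda>_. c"] assms by (simp add: open_star_def)

lemma open_star_mono: "c \<le> d \<Longrightarrow> open_star q G c \<subseteq> open_star q G d"
  by (force simp: open_star_def)

lemma openin_open_leg: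
  assumes st: "star_at X q G" and g: "g \<in> G" and ab: "0 \<le> a" "b \<le> 1"
  shows "openin (top_of_set X) (g ` {a<..<b})"
proof -
  have "g ` {a<..<b} = open_star q G 1 - (g ` {0..a} \<union> g ` {b..1} \<union> (\<Union>h\<in>G-{g}. h ` {0..1}) \<union> {q})"
    (is "?L = ?R")
  proof
    show "?L \<subseteq> ?R"
    proof
      fix x assume "x \<in> ?L"
      then obtain t where t: "x = g t" "a < t" "t < b" by auto
      then have t01: "t \<in> {0<..<1}" using ab by auto
      have "x \<in> g ` {0..<1}" using t(1) t01 by auto
      then have "x \<in> open_star q G 1" using g by (auto simp: open_star_def)
      moreover have u: "h = g \<and> s = t" if "h \<in> G" "s \<in> {0..1}" "x = h s" for h s
        using star_at_unique[OF st that(1) g that(2) t01] that t by simp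
      have "x \<notin> g ` {0..a}"
      proof
        assume "x \<in> g ` {0..a}"
        then obtain s where "s \<in> {0..a}" "x = g s" by blast
        then show False using u[OF g, of s] t ab by simp
      qed
      moreover have "x \<notin> g ` {b..1}"
      proof
        assume "x \<in> g ` {b..1}"
        then obtain s where "s \<in> {b..1}" "x = g s" by blast
        then show False using u[OF g, of s] t ab by simp
      qed
      moreover have "x \<notin> (\<Union>h\<in>G-{g}. h ` {0..1})" using u by blast
      moreover have "x \<noteq> q" using star_at_center[OF st g] t t01 by auto
      ultimately show "x \<in> ?R" by blast
    qed
    show "?R \<subseteq> ?L" by (force simp: open_star_def)
  qed
  moreover have "compact (g ` {0..a} \<union> g ` {b..1} \<union> (\<Union>h\<in>G-{g}. h ` {0..1}) \<union> {q})" if "a < b"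
    using st compact_leg[OF st g] compact_leg[OF st] ab that
    by (intro compact_Un compact_UN) (auto simp: star_at_def)
  ultimately show ?thesis
    using openin_minus_compact[OF openin_open_star[OF st]] by (cases "a < b") auto
qed

text \<open>
  A point of B on each leg cuts the star: the part of the star before these points is open, and
  adding the points themselves, which W avoids, makes it compact. Hence its trace on W is clopen.
\<close>

lemma star_barrier:
  assumes st: "star_at X q G" and meets: "\<And>g. g \<in> G \<Longrightarrow> B \<inter> g ` {1/2<..<1} \<noteq> {}"
    and W: "connected W" "W \<subseteq> X" "W \<inter> B = {}" "W \<inter> open_star q G (1/2) \<noteq> {}"
  shows "\<exists>c. 1/2 \<le> c \<and> c < 1 \<and> W \<subseteq> open_star q G c"
proof -
  have "\<forall>g\<in>G. \<exists>s. s \<in> {1/2<..<1} \<and> g s \<in> B" using meets by blast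
  then obtain s where s: "\<And>g. g \<in> G \<Longrightarrow> s g \<in> {1/2<..<1} \<and> g (s g) \<in> B" by metis
  have fin: "finite G" using st by (simp add: star_at_def)
  define T where "T = insert q (\<Union>g\<in>G. g ` {0..<s g})"
  define T' where "T' = insert q (\<Union>g\<in>G. g ` {0..s g})"
  have s01: "0 < s g \<and> s g \<le> 1" if "g \<in> G" for g using s[OF that] by auto
  have "openin (top_of_set X) T"
    using openin_truncated_star[OF st s01] unfolding T_def .
  then obtain V where "open V" "T = X \<inter> V" unfolding openin_open by blast
  moreover from this have "W \<inter> T = W \<inter> V" using W(2) by blast
  ultimately have "openin (top_of_set W) (W \<inter> T)" by (simp add: openin_open_Int)
  moreover have "compact T'" unfolding T'_def
    using fin s01 compact_leg[OF st] by (intro compact_insert compact_UN) auto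
  then have "closedin (top_of_set W) (W \<inter> T')"
    by (simp add: closedin_closed_Int compact_imp_closed)
  moreover have "W \<inter> T' = W \<inter> T"
  proof -
    have "x \<in> T" if "x \<in> W" "x \<in> T'" for x
    proof (cases "x = q")
      case False
      then obtain g t where g: "g \<in> G" "t \<in> {0..s g}" "x = g t" using \<open>x \<in> T'\<close> by (auto simp: T'_def)
      then have "t \<noteq> s g" using s[OF g(1)] W(3) that by auto
      then have "x \<in> g ` {0..<s g}" using g by auto
      then show ?thesis using g(1) by (auto simp: T_def)
    qed (simp add: T_def)
    moreover have "T \<subseteq> T'" by (force simp: T_def T'_def)
    ultimately show ?thesis by blast
  qed
  ultimately have "W \<inter> T = {} \<or> W \<inter> T = W" using W(1) by (metis connected_clopen)
  moreover have "open_star q G (1/2) \<subseteq> T" 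
  proof -
    have "g ` {0..<1/2} \<subseteq> g ` {0..<s g}" if "g \<in> G" for g using s[OF that] by (intro image_mono) auto
    then show ?thesis unfolding open_star_def T_def by blast
  qed
  ultimately have WT: "W \<subseteq> T" using W(4) by blast
  define c where "c = Max (insert (1/2) (s ` G))"
  have c: "1/2 \<le> c" "\<And>g. g \<in> G \<Longrightarrow> s g \<le> c"
    unfolding c_def by (rule Max_ge; use fin in simp)+
  have "c < 1" unfolding c_def using fin s by (subst Max_less_iff) auto
  moreover have "T \<subseteq> open_star q G c" 
  proof -
    have "g ` {0..<s g} \<subseteq> g ` {0..<c}" if "g \<in> G" for g using c(2)[OF that] by (intro image_mono) auto
    then show ?thesis unfolding open_star_def T_def by blast
  qed
  ultimately show ?thesis using WT c(1) by blast
qed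

lemma star_at_shrink:
  assumes st: "star_at X q G" and r: "\<And>g. g \<in> G \<Longrightarrow> 0 < r g \<and> r g \<le> 1"
  shows "star_at X q ((\<lambda>g s. g (r g * s)) ` G)"
proof -
  let ?f = "\<lambda>g s. g (r g * s)"
  have rs: "r g * s \<in> {0..1}" if "g \<in> G" "s \<in> {0..1}" for g s
    using r[OF that(1)] that(2) mult_le_one[of "r g" s] by auto
  have rs': "r g * s \<in> {0<..<1}" if "g \<in> G" "s \<in> {0<..<1}" for g s
    using r[OF that(1)] that(2) mult_le_less_imp_less[of "r g" 1 s 1] by auto
  have "continuous_on {0..1} (?f g) \<and> inj_on (?f g) {0..1} \<and> ?f g ` {0..1} \<subseteq> X \<and> ?f g 0 = q"
    if g: "g \<in> G" for g
  proof (intro conjI)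
    note L = star_at_leg[OF st g]
    show "continuous_on {0..1} (?f g)"
      using rs[OF g] by (intro continuous_on_compose2[OF L(1)] continuous_intros) auto
    show "inj_on (?f g) {0..1}"
    proof (rule inj_onI)
      fix x y :: real assume "x \<in> {0..1}" "y \<in> {0..1}" "?f g x = ?f g y"
      then have "r g * x = r g * y" using inj_onD[OF L(2)] rs[OF g] by blast
      then show "x = y" using r[OF g] by simp
    qed
    show "?f g ` {0..1} \<subseteq> X" using L(3) rs[OF g] by blast
    show "?f g 0 = q" using L(4) by simp
  qed
  moreover have "?f g ` {0<..<1} \<inter> ?f h ` {0..1} = {}" if gh: "g \<in> G" "h \<in> G" "?f g \<noteq> ?f h" for g h
  proof -
    have "g \<noteq> h" using gh(3) by auto
    then have "g ` {0<..<1} \<inter> h ` {0..1} = {}" using star_at_disjoint[OF st gh(1,2)] by simp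
    moreover have "?f g ` {0<..<1} \<subseteq> g ` {0<..<1}" using rs'[OF gh(1)] by blast
    moreover have "?f h ` {0..1} \<subseteq> h ` {0..1}" using rs[OF gh(2)] by blast
    ultimately show ?thesis by blast
  qed
  moreover have "(\<Union>f\<in>?f ` G. f ` {0..<1}) = (\<Union>g\<in>G. g ` {0..<r g})"
  proof -
    have "?f g ` {0..<1} = g ` {0..<r g}" if "g \<in> G" for g
    proof -
      have "(\<lambda>s. r g * s) ` {0..<1} = {0..<r g}"
      proof (intro equalityI subsetI)
        fix x assume "x \<in> {0..<r g}"
        then show "x \<in> (\<lambda>s. r g * s) ` {0..<1}" using r[OF that]
          by (intro image_eqI[of _ _ "x / r g"]) (auto simp: field_simps)
      qed (use r[OF that] in \<open>auto simp: mult_less_cancel_left2\<close>)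
      then show ?thesis by (metis image_image)
    qed
    then show ?thesis by auto
  qed
  ultimately show ?thesis
    using st openin_truncated_star[OF st r] unfolding star_at_def by simp
qed

section \<open>Small stars in a finite graph\<close>

text \<open>
  Parametrized arcs are easier to cut into legs than arcs given as sets.
\<close>

definition arc_decomposition :: "'a::metric_space set \<Rightarrow> (real \<Rightarrow> 'a) set \<Rightarrow> bool" where
  "arc_decomposition X \<Gamma> \<longleftrightarrow> finite \<Gamma> \<and> X = (\<Union>g\<in>\<Gamma>. g ` {0..1}) \<and>
     (\<forall>g\<in>\<Gamma>. continuous_on {0..1} g \<and> inj_on g {0..1}) \<and>
     (\<forall>g\<in>\<Gamma>. \<forall>h\<in>\<Gamma>. g \<noteq> h \<longrightarrow> g ` {0<..<1} \<inter> h ` {0..1} = {})"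

text \<open>
  End points are preserved by every change of parametrization: removing 0 or 1 from the unit
  interval leaves it connected, removing any other point does not.
\<close>

lemma arc_endpoints_subset:
  fixes A :: "'a::metric_space set"
  assumes "homeomorphism {0..1::real} A f g"
  shows "arc_endpoints A \<subseteq> {f 0, f 1}"
proof
  fix p assume "p \<in> arc_endpoints A"
  then obtain f' g' where f': "homeomorphism {0..1::real} A f' g'" "p = f' 0 \<or> p = f' 1"
    by (auto simp: arc_endpoints_def)
  then obtain e :: real where e: "e \<in> {0,1}" "p = f' e" by auto
  define k where "k = g \<circ> f'"
  define s where "s = k e"
  have hk: "homeomorphism {0..1} {0..1} k (g' \<circ> f)"
    unfolding k_def by (rule homeomorphism_compose[OF f'(1) homeomorphism_symD[OF assms]])
  have "p \<in> A" using f'(1) e by (auto simp: homeomorphism_def)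
  then have p: "p = f s" using assms by (simp add: s_def k_def e homeomorphism_def)
  have inj: "inj_on k {0..1}" 
    by (rule inj_on_inverseI[of _ "g' \<circ> f"]) (use homeomorphism_apply1[OF hk] in simp)
  have img: "k ` {0..1} = {0..1}" using homeomorphism_image1[OF hk] .
  have s01: "s \<in> {0..1}" unfolding s_def using img e(1) by force
  have "connected (k ` ({0..1} - {e}))"
  proof (rule connected_continuous_image)
    show "continuous_on ({0..1} - {e}) k"
      using homeomorphism_cont1[OF hk] by (rule continuous_on_subset) auto
    have "{0..1} - {e} = {0<..1} \<or> {0..1} - {e} = {0..<1}" using e(1) by fastforce
    then show "connected ({0..1} - {e})" by (elim disjE) simp_all
  qed
  moreover have "k ` ({0..1} - {e}) = {0..1} - {s}"
  proof -
    have "e \<in> {0..1}" using e(1) by auto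
    then have "k ` ({0..1} - {e}) = k ` {0..1} - k ` {e}" by (intro inj_on_image_set_diff[OF inj]) auto
    then show ?thesis by (simp only: img image_insert image_empty s_def)
  qed
  ultimately have c: "connected ({0..1} - {s})" by simp
  have "s = 0 \<or> s = 1"
  proof (rule ccontr)
    assume "\<not> ?thesis"
    then have "s \<in> {0..1} - {s}" using c s01 connectedD_interval[OF c, of 0 1 s] by auto
    then show False by simp
  qed
  then show "p \<in> {f 0, f 1}" using p by auto
qed

lemma finite_graph_arc_decomposition:
  assumes "finite_graph X"
  shows "\<exists>\<Gamma>. arc_decomposition X \<Gamma>"
proof -
  obtain \<A> where \<A>: "finite \<A>" "\<forall>A\<in>\<A>. is_arc A" "X = \<Union>\<A>"
    "\<forall>A\<in>\<A>. \<forall>B\<in>\<A>. A \<noteq> B \<longrightarrow> A \<inter> B \<subseteq> arc_endpoints A \<inter> arc_endpoints B"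
    using conjunct2[OF assms[unfolded finite_graph_def]] by (elim exE conjE)
  have "\<exists>f g. homeomorphism {0..1::real} A f g" if "A \<in> \<A>" for A
    using \<A>(2) that homeomorphic_sym unfolding is_arc_def homeomorphic_def by blast
  then obtain f g where fg: "\<And>A. A \<in> \<A> \<Longrightarrow> homeomorphism {0..1::real} A (f A) (g A)" by metis
  have img: "f A ` {0..1} = A" if "A \<in> \<A>" for A using homeomorphism_image1[OF fg[OF that]] .
  have inj: "inj_on (f A) {0..1}" if "A \<in> \<A>" for A
    by (rule inj_on_inverseI[of _ "g A"]) (use homeomorphism_apply1[OF fg[OF that]] in simp)
  have disj: "f A ` {0<..<1} \<inter> f B ` {0..1} = {}" if AB: "A \<in> \<A>" "B \<in> \<A>" "A \<noteq> B" for A B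
  proof -
    have "A \<inter> B \<subseteq> {f A 0, f A 1}" using \<A>(4) AB arc_endpoints_subset[OF fg[OF AB(1)]] by blast
    moreover have "f A t \<notin> {f A 0, f A 1}" if "t \<in> {0<..<1}" for t
      using inj_onD[OF inj[OF AB(1)], of t 0] inj_onD[OF inj[OF AB(1)], of t 1] that by auto
    moreover have "f A ` {0<..<1} \<subseteq> A" using img[OF AB(1)] by force
    ultimately show ?thesis using img[OF AB(2)] by blast
  qed
  have "arc_decomposition X (f ` \<A>)"
    unfolding arc_decomposition_def
  proof (intro conjI ballI impI)
    show "finite (f ` \<A>)" using \<A>(1) by simp
    show "X = (\<Union>g\<in>f ` \<A>. g ` {0..1})" using \<A>(3) img by auto
    show "continuous_on {0..1} h" if "h \<in> f ` \<A>" for h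
      using that homeomorphism_cont1[OF fg] by auto
    show "inj_on h {0..1}" if "h \<in> f ` \<A>" for h
      using that inj by auto
    show "h ` {0<..<1} \<inter> k ` {0..1} = {}" if hk: "h \<in> f ` \<A>" "k \<in> f ` \<A>" "h \<noteq> k" for h k
    proof -
      obtain A B where "A \<in> \<A>" "B \<in> \<A>" "h = f A" "k = f B" using hk by blast
      moreover from this have "A \<noteq> B" using hk(3) by auto
      ultimately show ?thesis using disj by simp
    qed
  qed
  then show ?thesis by blast
qed

lemma arc_decompositionD:
  assumes "arc_decomposition X \<Gamma>"
  shows "finite \<Gamma>" "X = (\<Union>g\<in>\<Gamma>. g ` {0..1})"
    and "g \<in> \<Gamma> \<Longrightarrow> continuous_on {0..1} g" "g \<in> \<Gamma> \<Longrightarrow> inj_on g {0..1}"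
    and "g \<in> \<Gamma> \<Longrightarrow> h \<in> \<Gamma> \<Longrightarrow> g \<noteq> h \<Longrightarrow> g ` {0<..<1} \<inter> h ` {0..1} = {}"
  using assms by (simp_all add: arc_decomposition_def)

text \<open>
  This reparametrizes the part of an arc between the parameter c and one of the two ends d as a leg
  that starts at c.
\<close>

lemma segment_in_unit:
  fixes c d t :: real
  assumes "c \<in> {0..1}" "d \<in> {0,1}" "d \<noteq> c"
  shows "t \<in> {0..1} \<Longrightarrow> c + t * (d - c) \<in> {0..1}"
    and "t \<in> {0<..<1} \<Longrightarrow> c + t * (d - c) \<in> {0<..<1}"
proof -
  have eq: "c + t * (d - c) = (1 - t) * c + t * d" by (simp add: algebra_simps)
  show "c + t * (d - c) \<in> {0..1}" if "t \<in> {0..1}"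
    unfolding eq using that assms convex_bound_le[of c 1 d "1-t" t] by auto
  show "c + t * (d - c) \<in> {0<..<1}" if t: "t \<in> {0<..<1}"
  proof (cases "d = 0")
    case True
    then have "0 < (1 - t) * c" "(1 - t) * c < 1"
      using t assms mult_pos_pos[of "1-t" c] mult_less_le_imp_less[of "1-t" 1 c 1] by auto
    then show ?thesis unfolding eq using True by simp
  next
    case False
    then have "d = 1" using assms by simp
    moreover have "(1 - t) * c < (1 - t) * 1"
      using t assms \<open>d = 1\<close> by (intro mult_strict_left_mono) auto
    moreover have "0 \<le> (1 - t) * c" using t assms by auto
    ultimately show ?thesis unfolding eq using t by auto
  qed
qed

text \<open>
  The legs at q are all segments that lead from q to an end of an arc through q. The open star is
  what is left of X after removing the arcs that miss q and the outer ends of the legs.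
\<close>

lemma arc_decomposition_star:
  assumes dec: "arc_decomposition X \<Gamma>" and q: "q \<in> X"
  shows "\<exists>G. star_at X q G"
proof -
  note arcs = arc_decompositionD[OF dec]
  define \<Gamma>q where "\<Gamma>q = {g\<in>\<Gamma>. q \<in> g ` {0..1}}"
  have "\<forall>g\<in>\<Gamma>q. \<exists>c. c \<in> {0..1} \<and> g c = q" by (auto simp: \<Gamma>q_def)
  then obtain c where c: "\<And>g. g \<in> \<Gamma>q \<Longrightarrow> c g \<in> {0..1::real} \<and> g (c g) = q" by metis
  \<comment> \<open>For an arc g through q and d equal to 0 or 1, \<open>\<phi> g d\<close> is the leg along g from q to g d.\<close>
  define \<phi> where "\<phi> g d t = g (c g + t * (d - c g))" for g :: "real \<Rightarrow> 'a" and d t :: real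
  define I where "I = {(g, d). g \<in> \<Gamma>q \<and> d \<in> {0, 1} \<and> d \<noteq> c g}"
  define G where "G = (\<lambda>(g, d). \<phi> g d) ` I"
  have I: "g \<in> \<Gamma>" "c g \<in> {0..1}" "d \<in> {0,1}" "d \<noteq> c g" "g (c g) = q" "g \<in> \<Gamma>q" if "(g, d) \<in> I" for g d
  proof -
    show gq: "g \<in> \<Gamma>q" and "d \<in> {0,1}" "d \<noteq> c g" using that by (simp_all add: I_def)
    show "g \<in> \<Gamma>" using gq unfolding \<Gamma>q_def by blast
    show "c g \<in> {0..1}" "g (c g) = q" using c[OF gq] by blast+
  qed
  note seg = segment_in_unit[OF I(2-4)]
  have GI: "\<phi> g d \<in> G" if "(g, d) \<in> I" for g d using that by (force simp: G_def)
  have GE: "\<exists>g d. (g, d) \<in> I \<and> f = \<phi> g d" if "f \<in> G" for f using that by (auto simp: G_def)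
  have "finite G"
  proof -
    have "I \<subseteq> \<Gamma> \<times> {0,1}" by (auto simp: I_def \<Gamma>q_def)
    moreover have "finite (\<Gamma> \<times> {0,1::real})" using arcs(1) by simp
    ultimately show ?thesis unfolding G_def using finite_subset by blast
  qed
  moreover have leg: "continuous_on {0..1} (\<phi> g d)" "inj_on (\<phi> g d) {0..1}" "\<phi> g d ` {0..1} \<subseteq> X"
    "\<phi> g d 0 = q" if "(g, d) \<in> I" for g d
  proof -
    show "continuous_on {0..1} (\<phi> g d)" unfolding \<phi>_def
    proof (rule continuous_on_compose2[OF arcs(3)[OF I(1)[OF that]]])
      show "continuous_on {0..1} (\<lambda>t. c g + t * (d - c g))" by (intro continuous_intros)
      show "(\<lambda>t. c g + t * (d - c g)) ` {0..1} \<subseteq> {0..1}"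
        by (rule image_subsetI) (rule seg(1)[OF that that that])
    qed
    show "inj_on (\<phi> g d) {0..1}"
    proof (rule inj_onI)
      fix x y :: real assume "x \<in> {0..1}" "y \<in> {0..1}" "\<phi> g d x = \<phi> g d y"
      then have "c g + x * (d - c g) = c g + y * (d - c g)"
        unfolding \<phi>_def by (intro inj_onD[OF arcs(4)[OF I(1)[OF that]]] seg(1)[OF that that that])
      then show "x = y" using I(4)[OF that] by simp
    qed
    show "\<phi> g d ` {0..1} \<subseteq> X"
    proof (rule image_subsetI)
      fix t :: real assume "t \<in> {0..1}"
      then have "\<phi> g d t \<in> g ` {0..1}" unfolding \<phi>_def by (intro imageI seg(1)[OF that that that])
      then show "\<phi> g d t \<in> X" using I(1)[OF that] by (subst arcs(2)) (rule UN_I)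
    qed
    show "\<phi> g d 0 = q" using I(5)[OF that] by (simp add: \<phi>_def)
  qed
  moreover have disjG: "\<phi> g d ` {0<..<1} \<inter> \<phi> h e ` {0..1} = {}"
    if gh: "(g, d) \<in> I" "(h, e) \<in> I" "\<phi> g d \<noteq> \<phi> h e" for g d h e
  proof (cases "g = h")
    case False
    have "\<phi> g d ` {0<..<1} \<subseteq> g ` {0<..<1}" "\<phi> h e ` {0..1} \<subseteq> h ` {0..1}"
      unfolding \<phi>_def
      by (rule image_subsetI, rule imageI, rule seg(2)[OF gh(1) gh(1) gh(1)], assumption)
         (rule image_subsetI, rule imageI, rule seg(1)[OF gh(2) gh(2) gh(2)], assumption)
    then show ?thesis using arcs(5)[OF I(1)[OF gh(1)] I(1)[OF gh(2)] False] by blast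
  next
    case True
    then have "d \<noteq> e" using gh(3) by auto
    have "\<phi> g d t \<noteq> \<phi> h e s" if ts: "t \<in> {0<..<1}" "s \<in> {0..1}" for t s
    proof
      assume "\<phi> g d t = \<phi> h e s"
      then have "g (c g + t * (d - c g)) = g (c g + s * (e - c g))" unfolding \<phi>_def True .
      then have "c g + t * (d - c g) = c g + s * (e - c g)"
      proof (rule inj_onD[OF arcs(4)[OF I(1)[OF gh(1)]]])
        show "c g + t * (d - c g) \<in> {0..1}" using ts by (intro seg(1)[OF gh(1) gh(1) gh(1)]) auto
        show "c g + s * (e - c g) \<in> {0..1}" using seg(1)[OF gh(2) gh(2) gh(2) ts(2)] by (simp only: True)
      qed
      then have eq: "t * (d - c g) = s * (e - c g)" by simp
      have de: "(d = 0 \<and> e = 1) \<or> (d = 1 \<and> e = 0)" and cg: "0 < c g" "c g < 1"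
        using I(2-4)[OF gh(1)] I(2-4)[OF gh(2)] True \<open>d \<noteq> e\<close> by auto
      have "0 < t * c g" "0 < t * (1 - c g)" "0 \<le> s * c g" "0 \<le> s * (1 - c g)"
        using ts cg by auto
      then show False using eq de by (auto simp: algebra_simps)
    qed
    then show ?thesis by blast
  qed
  moreover have "openin (top_of_set X) (insert q (\<Union>f\<in>G. f ` {0..<1}))"
  proof -
    let ?K = "(\<Union>g\<in>\<Gamma>-\<Gamma>q. g ` {0..1}) \<union> (\<lambda>f. f 1) ` G"
    have "insert q (\<Union>f\<in>G. f ` {0..<1}) = X - ?K" (is "?L = ?R")
    proof
      have ends: "\<phi> g d t \<noteq> \<phi> h e 1" if gh: "(g, d) \<in> I" "(h, e) \<in> I" and t: "t \<in> {0..<1}" for g d h e t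
      proof (cases "t = 0 \<or> \<phi> g d = \<phi> h e")
        case True
        have ne: "\<phi> h e s \<noteq> \<phi> h e 1" if "s \<in> {0..<1}" for s
          using inj_onD[OF leg(2)[OF gh(2)], of s 1] that by force
        from True show ?thesis
        proof
          assume "t = 0"
          then show ?thesis using ne[of 0] leg(4)[OF gh(1)] leg(4)[OF gh(2)] by simp
        next
          assume "\<phi> g d = \<phi> h e"
          then show ?thesis using ne[OF t] by simp
        qed
      next
        case False
        then have "\<phi> g d t \<in> \<phi> g d ` {0<..<1}" using t by auto
        moreover have "\<phi> h e 1 \<in> \<phi> h e ` {0..1}" by simp
        ultimately show ?thesis using disjG[OF gh] False by (metis disjoint_iff)
      qed
      show "?L \<subseteq> ?R"
      proof
        fix x assume "x \<in> ?L"
        have "\<exists>g d t. (g, d) \<in> I \<and> x = \<phi> g d t \<and> t \<in> {0<..<1}" if xq: "x \<noteq> q"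
        proof -
          obtain f t where f: "f \<in> G" "x = f t" "t \<in> {0..<1}" using \<open>x \<in> ?L\<close> xq by blast
          then obtain g d where gd: "(g, d) \<in> I" "f = \<phi> g d" using GE by blast
          then have "t \<noteq> 0" using leg(4)[OF gd(1)] f xq by metis
          then have "t \<in> {0<..<1}" using f(3) by simp
          then show ?thesis using gd f(2) by blast
        qed
        then consider "x = q" | g d t where "(g, d) \<in> I" "x = \<phi> g d t" "t \<in> {0<..<1}" by blast
        then show "x \<in> ?R"
        proof cases
          case 1
          have "q \<noteq> \<phi> g d 1" if "(g, d) \<in> I" for g d
            using ends[OF that that, of 0] leg(4)[OF that] by simp
          then have "q \<notin> (\<lambda>f. f 1) ` G" using GE by blast
          moreover have "q \<notin> (\<Union>g\<in>\<Gamma>-\<Gamma>q. g ` {0..1})" unfolding \<Gamma>q_def by blast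
          ultimately show ?thesis using 1 q by blast
        next
          case 2
          have "x \<noteq> \<phi> h e 1" if "(h, e) \<in> I" for h e 
            using ends[OF 2(1) that, of t] 2(2,3) by simp
          then have "x \<notin> (\<lambda>f. f 1) ` G" using GE by blast
          moreover have "x \<in> g ` {0<..<1}" using 2(2,3) seg(2)[OF 2(1) 2(1) 2(1), of t] by (simp add: \<phi>_def)
          then have "x \<notin> h ` {0..1}" if "h \<in> \<Gamma> - \<Gamma>q" for h
            using arcs(5)[OF I(1)[OF 2(1)], of h] that I(6)[OF 2(1)] by blast
          moreover have "x \<in> X" using leg(3)[OF 2(1)] 2 by force
          ultimately show ?thesis by blast
        qed
      qed
      show "?R \<subseteq> ?L"
      proof
        fix x assume x: "x \<in> ?R"
        then obtain g t where g: "g \<in> \<Gamma>" "t \<in> {0..1}" "x = g t" using arcs(2) by blast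
        then have gq: "g \<in> \<Gamma>q" using x by blast
        note cg = c[OF gq]
        show "x \<in> ?L"
        proof (cases "t = c g")
          case True
          then show ?thesis using cg g by simp
        next
          case False
          define d :: real where "d = (if t < c g then 0 else 1)"
          define u where "u = (t - c g) / (d - c g)"
          have d: "d \<noteq> c g" using False g cg by (auto simp: d_def)
          then have gd: "(g, d) \<in> I" using gq by (auto simp: I_def d_def)
          have tu: "t = c g + u * (d - c g)" using d by (simp add: u_def)
          then have xu: "x = \<phi> g d u" using g by (simp add: \<phi>_def)
          have "u \<in> {0..1}"
            using False g cg d by (auto simp: u_def d_def divide_simps split: if_splits)
          moreover have "u \<noteq> 1" using x xu GI[OF gd] by blast
          ultimately have "x \<in> \<phi> g d ` {0..<1}" using xu by auto
          then show ?thesis using GI[OF gd] by blast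
        qed
      qed
    qed
    moreover have "compact (\<Union>g\<in>\<Gamma>-\<Gamma>q. g ` {0..1})"
      using arcs(1,3) by (intro compact_UN compact_continuous_image) auto
    then have "compact ?K" using \<open>finite G\<close> by (simp add: compact_Un finite_imp_compact)
    ultimately show ?thesis using openin_minus_compact[of X X ?K] by simp
  qed
  ultimately have "star_at X q G"
    unfolding star_at_def using q GE by (smt (verit, best))
  then show ?thesis by blast
qed

text \<open>
  Otherwise points of A and points outside A alternate infinitely often along the leg towards q. Two
  of the points outside A cut off the part of A between them on the leg from a further point of A,
  against the connectedness of A.
\<close>

lemma leg_eventually_homogeneous:
  assumes st: "star_at X q G" and g: "g \<in> G" and A: "connected A" "A \<subseteq> X"
  shows "\<exists>\<eta>. 0 < \<eta> \<and> \<eta> < 1 \<and> (g ` {0<..\<eta>} \<subseteq> A \<or> g ` {0<..\<eta>} \<inter> A = {})"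
proof (rule ccontr)
  assume neg: "\<not> ?thesis"
  have ex: "(\<exists>x. 0 < x \<and> x < \<eta> \<and> g x \<in> A) \<and> (\<exists>x. 0 < x \<and> x < \<eta> \<and> g x \<notin> A)"
    if \<eta>: "0 < \<eta>" "\<eta> \<le> 1" for \<eta>
  proof -
    have "\<not> (g ` {0<..\<eta>/2} \<subseteq> A \<or> g ` {0<..\<eta>/2} \<inter> A = {})"
      using neg \<eta> by (auto dest!: spec[of _ "\<eta>/2"])
    then obtain x y where "x \<in> {0<..\<eta>/2}" "y \<in> {0<..\<eta>/2}" "g x \<in> A" "g y \<notin> A" by blast
    then show ?thesis using \<eta> by (intro conjI exI[of _ x] exI[of _ y]) auto
  qed
  obtain a1 where a1: "0 < a1" "a1 < 1" "g a1 \<in> A" using ex[of 1] by auto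
  obtain b1 where b1: "0 < b1" "b1 < a1" "g b1 \<notin> A" using ex[of a1] a1 by auto
  obtain a2 where a2: "0 < a2" "a2 < b1" "g a2 \<in> A" using ex[of b1] a1 b1 by auto
  obtain b2 where b2: "0 < b2" "b2 < a2" "g b2 \<notin> A" using ex[of a2] a1 b1 a2 by auto
  let ?S = "A \<inter> g ` {b2<..<b1}"
  have "openin (top_of_set X) (g ` {b2<..<b1})"
    using openin_open_leg[OF st g] a1 b1 b2 by simp
  then obtain V where V: "open V" "g ` {b2<..<b1} = X \<inter> V" unfolding openin_open by blast
  then have "?S = A \<inter> V" using A(2) by blast
  then have "openin (top_of_set A) ?S" using V(1) by (simp add: openin_open_Int)
  moreover have "?S = A \<inter> g ` {b2..b1}"
  proof -
    have "x \<in> g ` {b2<..<b1}" if xA: "x \<in> A" "x \<in> g ` {b2..b1}" for x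
    proof -
      obtain t where t: "t \<in> {b2..b1}" "x = g t" using xA by blast
      then have "t \<noteq> b1" "t \<noteq> b2" using xA b1 b2 by auto
      then show ?thesis using t by auto
    qed
    then show ?thesis by force
  qed
  then have "closedin (top_of_set A) ?S"
    using compact_leg[OF st g, of b2 b1] a1 b1 b2 by (simp add: closedin_closed_Int compact_imp_closed)
  ultimately have "?S = {} \<or> ?S = A" using A(1) by (metis connected_clopen)
  moreover have "g a2 \<in> ?S" using a2 b2 by auto
  moreover have "g a1 \<notin> ?S"
  proof
    assume "g a1 \<in> ?S"
    then obtain t where "t \<in> {b2<..<b1}" "g a1 = g t" by blast
    then show False using inj_onD[OF star_at_leg(2)[OF st g], of a1 t] a1 b1 b2 by auto
  qed
  ultimately show False using a1(3) by blast
qed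

lemma small_homogeneous_star:
  assumes X: "finite_graph X" and q: "q \<in> X" and A: "connected A" "A \<subseteq> X" and "0 < r"
  shows "\<exists>G. star_at X q G \<and>
    (\<forall>g\<in>G. g ` {0..1} \<subseteq> ball q r \<and> (g ` {0<..1} \<subseteq> A \<or> g ` {0<..1} \<inter> A = {}))"
proof -
  obtain G where st: "star_at X q G"
    using finite_graph_arc_decomposition[OF X] arc_decomposition_star q by blast
  have "\<exists>\<eta>. 0 < \<eta> \<and> \<eta> \<le> 1 \<and> g ` {0..\<eta>} \<subseteq> ball q r \<and> (g ` {0<..\<eta>} \<subseteq> A \<or> g ` {0<..\<eta>} \<inter> A = {})"
    if g: "g \<in> G" for g
  proof -
    obtain \<eta>1 where \<eta>1: "0 < \<eta>1" "\<eta>1 < 1" "g ` {0<..\<eta>1} \<subseteq> A \<or> g ` {0<..\<eta>1} \<inter> A = {}"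
      using leg_eventually_homogeneous[OF st g A] by blast
    obtain \<eta>2 where \<eta>2: "0 < \<eta>2" "\<And>t. t \<in> {0..1} \<Longrightarrow> dist t 0 < \<eta>2 \<Longrightarrow> dist (g t) (g 0) < r"
      using star_at_leg(1)[OF st g] \<open>0 < r\<close> unfolding continuous_on_iff by (metis atLeastAtMost_iff order.refl zero_le_one)
    define \<eta> where "\<eta> = min \<eta>1 (\<eta>2 / 2)"
    have "0 < \<eta>" "\<eta> \<le> 1" using \<eta>1 \<eta>2 by (auto simp: \<eta>_def)
    moreover have "g ` {0..\<eta>} \<subseteq> ball q r"
    proof
      fix x assume "x \<in> g ` {0..\<eta>}"
      then obtain t where "t \<in> {0..\<eta>}" "x = g t" by blast
      then show "x \<in> ball q r"
        using \<eta>2(2)[of t] \<eta>2(1) \<open>\<eta> \<le> 1\<close> star_at_leg(4)[OF st g] by (auto simp: \<eta>_def dist_commute)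
    qed
    moreover have "g ` {0<..\<eta>} \<subseteq> g ` {0<..\<eta>1}" by (intro image_mono) (auto simp: \<eta>_def)
    then have "g ` {0<..\<eta>} \<subseteq> A \<or> g ` {0<..\<eta>} \<inter> A = {}" using \<eta>1(3) by blast
    ultimately show ?thesis by blast
  qed
  then obtain \<eta> where \<eta>: "\<And>g. g \<in> G \<Longrightarrow> 0 < \<eta> g \<and> \<eta> g \<le> 1 \<and> g ` {0..\<eta> g} \<subseteq> ball q r \<and>
      (g ` {0<..\<eta> g} \<subseteq> A \<or> g ` {0<..\<eta> g} \<inter> A = {})" by metis
  let ?G = "(\<lambda>g s. g (\<eta> g * s)) ` G"
  have "star_at X q ?G" using star_at_shrink[OF st] \<eta> by blast
  moreover have "f ` {0..1} \<subseteq> ball q r \<and> (f ` {0<..1} \<subseteq> A \<or> f ` {0<..1} \<inter> A = {})"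
    if fG: "f \<in> ?G" for f
  proof -
    obtain g where g: "g \<in> G" "f = (\<lambda>s. g (\<eta> g * s))" using fG by blast
    have sub: "f ` {0..1} \<subseteq> g ` {0..\<eta> g}" "f ` {0<..1} \<subseteq> g ` {0<..\<eta> g}"
      using \<eta>[OF g(1)] by (auto simp: g(2) mult_le_cancel_left1)
    have "g ` {0..\<eta> g} \<subseteq> ball q r" and hom: "g ` {0<..\<eta> g} \<subseteq> A \<or> g ` {0<..\<eta> g} \<inter> A = {}"
      using \<eta>[OF g(1)] by simp_all
    then have "f ` {0..1} \<subseteq> ball q r" using sub(1) by simp
    moreover from hom have "f ` {0<..1} \<subseteq> A \<or> f ` {0<..1} \<inter> A = {}" using sub(2) by blast
    ultimately show ?thesis ..
  qed
  ultimately show ?thesis by (intro exI[of _ ?G]) simp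
qed

section \<open>The topology of the hyperspace\<close>

lemma hausdorff_dist_lessI:
  assumes X: "compact X" and A: "A \<in> subcontinua X" and B: "B \<in> subcontinua X"
    and e: "0 < e" "e < r"
    and AB: "\<And>a. a \<in> A \<Longrightarrow> \<exists>b\<in>B. dist a b < e" and BA: "\<And>b. b \<in> B \<Longrightarrow> \<exists>a\<in>A. dist a b < e"
  shows "hausdorff_dist A B < r"
proof -
  note A' = subcontinua_compact[OF X A] and B' = subcontinua_compact[OF X B]
  have "A \<subseteq> (\<Union>b\<in>B. ball b e)" using AB by (force simp: dist_commute)
  moreover have "B \<subseteq> (\<Union>a\<in>A. ball a e)" using BA by force
  ultimately show ?thesis
    using e hausdorff_dist_less_iff[OF A'(2) B'(2) compact_imp_bounded[OF A'(1)] compact_imp_bounded[OF B'(1)]]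
    by blast
qed

lemma hausdorff_dist_lessD:
  assumes X: "compact X" and A: "A \<in> subcontinua X" and B: "B \<in> subcontinua X"
    and "hausdorff_dist A B < r"
  shows "a \<in> A \<Longrightarrow> \<exists>b\<in>B. dist a b < r" and "b \<in> B \<Longrightarrow> \<exists>a\<in>A. dist a b < r"
proof -
  note A' = subcontinua_compact[OF X A] and B' = subcontinua_compact[OF X B]
  obtain e where e: "e < r" "A \<subseteq> (\<Union>b\<in>B. ball b e)" "B \<subseteq> (\<Union>a\<in>A. ball a e)"
    using assms(4) hausdorff_dist_less_iff[OF A'(2) B'(2) compact_imp_bounded[OF A'(1)] compact_imp_bounded[OF B'(1)]]
    by blast
  show "\<exists>b\<in>B. dist a b < r" if "a \<in> A" using that e(1,2) by (force simp: dist_commute)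
  show "\<exists>a\<in>A. dist a b < r" if "b \<in> B" using that e(1,3) by force
qed

lemma openin_subcontinua_subset:
  assumes X: "compact X" and U: "openin (top_of_set X) U"
  shows "openin (subcontinua_topology X) {B \<in> subcontinua X. B \<subseteq> U}"
proof -
  interpret H: Metric_space "subcontinua X" hausdorff_dist by (rule Metric_space_subcontinua[OF X])
  show ?thesis
    unfolding subcontinua_topology_def H.openin_mtopology
  proof (intro conjI allI impI)
    fix B assume "B \<in> {B \<in> subcontinua X. B \<subseteq> U}"
    then have B: "B \<in> subcontinua X" "B \<subseteq> U" by auto
    obtain V where V: "open V" "U = X \<inter> V" using U unfolding openin_open by blast
    obtain r where r: "r > 0" "(\<Union>x\<in>B. ball x r) \<subseteq> V"
      using compact_subset_open_imp_ball_epsilon_subset[OF subcontinua_compact(1)[OF X B(1)] V(1)]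
        B(2) V(2) by blast
    have "H.mball B r \<subseteq> {B \<in> subcontinua X. B \<subseteq> U}"
    proof
      fix C assume "C \<in> H.mball B r"
      then have C: "C \<in> subcontinua X" "hausdorff_dist B C < r" by auto
      have "c \<in> U" if cC: "c \<in> C" for c
      proof -
        obtain b where "b \<in> B" "dist b c < r" using hausdorff_dist_lessD(2)[OF X B(1) C cC] by blast
        then have "c \<in> (\<Union>x\<in>B. ball x r)" by auto
        then have "c \<in> V" using r(2) by blast
        moreover have "c \<in> X" using C(1) cC closedin_imp_subset by (auto simp: subcontinua_def)
        ultimately show ?thesis using V by blast
      qed
      then show "C \<in> {B \<in> subcontinua X. B \<subseteq> U}" using C by blast
    qed
    then show "\<exists>r>0. H.mball B r \<subseteq> {B \<in> subcontinua X. B \<subseteq> U}" using r(1) by blast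
  qed blast
qed

lemma openin_subcontinua_meets:
  assumes X: "compact X" and U: "openin (top_of_set X) U"
  shows "openin (subcontinua_topology X) {B \<in> subcontinua X. B \<inter> U \<noteq> {}}"
proof -
  interpret H: Metric_space "subcontinua X" hausdorff_dist by (rule Metric_space_subcontinua[OF X])
  show ?thesis
    unfolding subcontinua_topology_def H.openin_mtopology
  proof (intro conjI allI impI)
    fix B assume "B \<in> {B \<in> subcontinua X. B \<inter> U \<noteq> {}}"
    then obtain b where B: "B \<in> subcontinua X" "b \<in> B" "b \<in> U" by auto
    obtain V where V: "open V" "U = X \<inter> V" using U unfolding openin_open by blast
    obtain r where r: "r > 0" "ball b r \<subseteq> V" using V B(3) open_contains_ball by (metis IntD2)
    have "H.mball B r \<subseteq> {B \<in> subcontinua X. B \<inter> U \<noteq> {}}"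
    proof
      fix C assume "C \<in> H.mball B r"
      then have C: "C \<in> subcontinua X" "hausdorff_dist B C < r" by auto
      obtain c where c: "c \<in> C" "dist b c < r" using hausdorff_dist_lessD(1)[OF X B(1) C B(2)] by blast
      moreover have "c \<in> X" using C(1) c closedin_imp_subset by (auto simp: subcontinua_def)
      ultimately have "c \<in> U" using V r by auto
      then show "C \<in> {B \<in> subcontinua X. B \<inter> U \<noteq> {}}" using C c by blast
    qed
    then show "\<exists>r>0. H.mball B r \<subseteq> {B \<in> subcontinua X. B \<inter> U \<noteq> {}}" using r(1) by blast
  qed blast
qed

lemma topspace_subcontinua_topology:
  "compact X \<Longrightarrow> topspace (subcontinua_topology X) = subcontinua X"
  by (simp add: subcontinua_topology_def Metric_space.topspace_mtopology Metric_space_subcontinua)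

text \<open>
  Closeness to a given subcontinuum is used below only through finitely many such conditions.
\<close>

lemma openin_vietoris:
  assumes X: "compact X" and U: "openin (top_of_set X) U"
    and \<O>: "finite \<O>" "\<And>V. V \<in> \<O> \<Longrightarrow> openin (top_of_set X) V"
  shows "openin (subcontinua_topology X) {B \<in> subcontinua X. B \<subseteq> U \<and> (\<forall>V\<in>\<O>. B \<inter> V \<noteq> {})}"
proof -
  have "openin (subcontinua_topology X)
    ((\<Inter>V\<in>\<O>. {B \<in> subcontinua X. B \<inter> V \<noteq> {}}) \<inter> topspace (subcontinua_topology X))"
    using \<O> openin_subcontinua_meets[OF X] by (intro openin_INT) auto
  then have "openin (subcontinua_topology X) ({B \<in> subcontinua X. B \<subseteq> U} \<inter>
    ((\<Inter>V\<in>\<O>. {B \<in> subcontinua X. B \<inter> V \<noteq> {}}) \<inter> topspace (subcontinua_topology X)))"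
    using openin_subcontinua_subset[OF X U] by (rule openin_Int[rotated])
  moreover have "{B \<in> subcontinua X. B \<subseteq> U} \<inter>
    ((\<Inter>V\<in>\<O>. {B \<in> subcontinua X. B \<inter> V \<noteq> {}}) \<inter> topspace (subcontinua_topology X)) =
    {B \<in> subcontinua X. B \<subseteq> U \<and> (\<forall>V\<in>\<O>. B \<inter> V \<noteq> {})}"
    unfolding topspace_subcontinua_topology[OF X] by blast
  ultimately show ?thesis by simp
qed

section \<open>Contracting arcs to their initial points\<close>

lemma powr_unit: "s \<in> {0..1} \<Longrightarrow> 0 < u \<Longrightarrow> s powr u \<in> {0..1}" for s u :: real
  using powr_mono2[of u s 1] by simp

text \<open>
  The legs of several disjoint stars are treated as one family: for the construction of the flow it
  only matters that the arcs without their ends are open and pairwise disjoint, while ends may be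
  shared.
\<close>

definition free_arcs :: "'a::metric_space set \<Rightarrow> (real \<Rightarrow> 'a) set \<Rightarrow> bool" where
  "free_arcs X \<Gamma> \<longleftrightarrow> finite \<Gamma> \<and>
     (\<forall>g\<in>\<Gamma>. continuous_on {0..1} g \<and> inj_on g {0..1} \<and> g ` {0..1} \<subseteq> X \<and>
        openin (top_of_set X) (g ` {0<..<1})) \<and>
     (\<forall>g\<in>\<Gamma>. \<forall>h\<in>\<Gamma>. g \<noteq> h \<longrightarrow> g ` {0<..<1} \<inter> h ` {0..1} = {})"

text \<open>
  The exponent u acts on the parameter by s \<mapsto> s powr u. This fixes 0 and 1, so the
  definition on the open arcs extends by the identity, and composition multiplies the exponents.
\<close>

definition flow :: "(real \<Rightarrow> 'a) set \<Rightarrow> real \<Rightarrow> 'a \<Rightarrow> 'a" where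
  "flow \<Gamma> u x =
     (if \<exists>g\<in>\<Gamma>. x \<in> g ` {0<..<1}
      then let g = SOME g. g \<in> \<Gamma> \<and> x \<in> g ` {0<..<1} in g (the_inv_into {0..1} g x powr u)
      else x)"

context
  fixes X :: "'a::metric_space set" and \<Gamma> :: "(real \<Rightarrow> 'a) set"
  assumes arcs: "free_arcs X \<Gamma>"
begin

lemma free_arcsD:
  shows "finite \<Gamma>" and "g \<in> \<Gamma> \<Longrightarrow> continuous_on {0..1} g" and "g \<in> \<Gamma> \<Longrightarrow> inj_on g {0..1}"
    and "g \<in> \<Gamma> \<Longrightarrow> g ` {0..1} \<subseteq> X" and "g \<in> \<Gamma> \<Longrightarrow> openin (top_of_set X) (g ` {0<..<1})"
    and "g \<in> \<Gamma> \<Longrightarrow> h \<in> \<Gamma> \<Longrightarrow> g \<noteq> h \<Longrightarrow> g ` {0<..<1} \<inter> h ` {0..1} = {}"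
  using arcs by (simp_all add: free_arcs_def)

lemma flow_off_arcs: "x \<notin> (\<Union>g\<in>\<Gamma>. g ` {0<..<1}) \<Longrightarrow> flow \<Gamma> u x = x"
  unfolding flow_def by (rule if_not_P) blast

lemma flow_on_arc:
  assumes g: "g \<in> \<Gamma>" and s: "s \<in> {0..1}" and u: "0 < u"
  shows "flow \<Gamma> u (g s) = g (s powr u)"
proof (cases "s \<in> {0<..<1}")
  case True
  then have gs: "g s \<in> g ` {0<..<1}" by blast
  have "h = g" if "h \<in> \<Gamma>" "g s \<in> h ` {0<..<1}" for h
  proof (rule ccontr)
    assume "h \<noteq> g"
    moreover have "g s \<in> g ` {0..1}" using s by blast
    ultimately show False using free_arcsD(6)[OF that(1) g] that(2) by blast
  qed
  then have "(SOME h. h \<in> \<Gamma> \<and> g s \<in> h ` {0<..<1}) = g" using g gs by (intro some_equality) blast+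
  moreover have "\<exists>h\<in>\<Gamma>. g s \<in> h ` {0<..<1}" using g gs by blast
  ultimately show ?thesis
    unfolding flow_def using the_inv_into_f_f[OF free_arcsD(3)[OF g] s] by (simp add: Let_def)
next
  case False
  then have s01: "s = 0 \<or> s = 1" using s by auto
  have "g s \<notin> h ` {0<..<1}" if "h \<in> \<Gamma>" for h
  proof
    assume h: "g s \<in> h ` {0<..<1}"
    moreover have "g s \<in> g ` {0..1}" using s by blast
    ultimately have "h = g" using free_arcsD(6)[OF that g] by blast
    then obtain t where "t \<in> {0<..<1}" "g s = g t" using h by blast
    then show False using inj_onD[OF free_arcsD(3)[OF g], of s t] s s01 by auto
  qed
  then have "flow \<Gamma> u (g s) = g s" by (intro flow_off_arcs) blast
  then show ?thesis using s01 u by auto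
qed

lemma flow_cases:
  assumes "x \<in> X"
  obtains "x \<notin> (\<Union>g\<in>\<Gamma>. g ` {0<..<1})" | g s where "g \<in> \<Gamma>" "s \<in> {0<..<1}" "x = g s"
  by blast

lemma flow_in:
  assumes "x \<in> X" "0 < u"
  shows "flow \<Gamma> u x \<in> X"
  using assms(1)
proof (cases rule: flow_cases)
  case 1
  then show ?thesis using flow_off_arcs assms by simp
next
  case (2 g s)
  then have "flow \<Gamma> u x = g (s powr u)" using flow_on_arc assms(2) by simp
  moreover have "s powr u \<in> {0..1}" using 2 assms(2) by (intro powr_unit) auto
  ultimately show ?thesis using free_arcsD(4)[OF 2(1)] by blast
qed

lemma flow_flow:
  assumes "x \<in> X" "0 < u" "0 < v"
  shows "flow \<Gamma> u (flow \<Gamma> v x) = flow \<Gamma> (v * u) x"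
  using assms(1)
proof (cases rule: flow_cases)
  case 1
  then show ?thesis using flow_off_arcs by simp
next
  case (2 g s)
  have "s powr v \<in> {0..1}" using 2 assms(3) by (intro powr_unit) auto
  then show ?thesis using 2 assms flow_on_arc[OF 2(1)] by (simp add: powr_powr)
qed

lemma flow_one:
  assumes "x \<in> X"
  shows "flow \<Gamma> 1 x = x"
  using assms
proof (cases rule: flow_cases)
  case 1
  then show ?thesis using flow_off_arcs by simp
next
  case (2 g s)
  then show ?thesis using flow_on_arc[OF 2(1), of s 1] by simp
qed

lemma flow_inverse:
  assumes "x \<in> X" "0 < u"
  shows "flow \<Gamma> (1/u) (flow \<Gamma> u x) = x" "flow \<Gamma> u (flow \<Gamma> (1/u) x) = x"
  using assms flow_flow[of x "1/u" u] flow_flow[of x u "1/u"] flow_one by simp_all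

text \<open>
  The sets on which the flow is given by one formula, namely the closed arcs and the complement of
  the open arcs, are finitely many closed sets. On a closed arc, s powr u is continuous also
  at s = 0, since u stays away from 0.
\<close>

lemma continuous_on_flow:
  assumes X: "compact X" and a: "0 < a"
  shows "continuous_on ({a..b} \<times> X) (\<lambda>(u, x). flow \<Gamma> u x)"
proof -
  let ?E = "X - (\<Union>g\<in>\<Gamma>. g ` {0<..<1})"
  have on: "continuous_on ({a..b} \<times> g ` {0..1}) (\<lambda>(u, x). flow \<Gamma> u x)" if g: "g \<in> \<Gamma>" for g
  proof -
    let ?i = "the_inv_into {0..1} g"
    have i: "?i x \<in> {0..1}" "g (?i x) = x" if "x \<in> g ` {0..1}" for x
      using that the_inv_into_into[OF free_arcsD(3)[OF g], of x "{0..1}"]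
        f_the_inv_into_f[OF free_arcsD(3)[OF g]] by auto
    have ci: "continuous_on (g ` {0..1}) ?i"
      using free_arcsD(2,3)[OF g] by (intro continuous_on_inv_into) auto
    have "continuous_on ({a..b} \<times> g ` {0..1}) (\<lambda>p. ?i (snd p) powr fst p)"
    proof (rule continuous_on_powr')
      show "continuous_on ({a..b} \<times> g ` {0..1}) (\<lambda>p. ?i (snd p))"
        by (rule continuous_on_compose2[OF ci]) (auto intro: continuous_on_snd continuous_on_id)
      show "continuous_on ({a..b} \<times> g ` {0..1}) (\<lambda>p. fst p)"
        by (intro continuous_on_fst continuous_on_id)
      show "\<forall>p\<in>{a..b} \<times> g ` {0..1}. 0 \<le> ?i (snd p) \<and> (?i (snd p) = 0 \<longrightarrow> 0 < fst p)"
      proof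
        fix p assume "p \<in> {a..b} \<times> g ` {0..1}"
        then have "a \<le> fst p" "snd p \<in> g ` {0..1}" by auto
        then show "0 \<le> ?i (snd p) \<and> (?i (snd p) = 0 \<longrightarrow> 0 < fst p)" using i(1) a by fastforce
      qed
    qed
    then have "continuous_on ({a..b} \<times> g ` {0..1}) (\<lambda>p. g (?i (snd p) powr fst p))"
    proof (rule continuous_on_compose2[OF free_arcsD(2)[OF g]])
      show "(\<lambda>p. ?i (snd p) powr fst p) ` ({a..b} \<times> g ` {0..1}) \<subseteq> {0..1}"
      proof (rule image_subsetI)
        fix p assume "p \<in> {a..b} \<times> g ` {0..1}"
        then have "a \<le> fst p" "snd p \<in> g ` {0..1}" by auto
        then show "?i (snd p) powr fst p \<in> {0..1}" using i(1) a by (intro powr_unit) auto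
      qed
    qed
    then show ?thesis
    proof (rule continuous_on_eq)
      fix p assume p: "p \<in> {a..b} \<times> g ` {0..1}"
      then have "a \<le> fst p" "snd p \<in> g ` {0..1}" by auto
      then have "flow \<Gamma> (fst p) (g (?i (snd p))) = g (?i (snd p) powr fst p)"
        using i(1) a by (intro flow_on_arc[OF g]) auto
      then show "g (?i (snd p) powr fst p) = (case p of (u, x) \<Rightarrow> flow \<Gamma> u x)"
        using i(2) \<open>snd p \<in> _\<close> by (simp add: case_prod_beta)
    qed
  qed
  have "compact (g ` {0..1})" if "g \<in> \<Gamma>" for g
    using free_arcsD(2)[OF that] by (rule compact_continuous_image) simp
  then have cl: "closed ({a..b} \<times> g ` {0..1})" if "g \<in> \<Gamma>" for g
    using that by (intro compact_imp_closed compact_Times) auto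
  have "continuous_on (\<Union>g\<in>\<Gamma>. {a..b} \<times> g ` {0..1}) (\<lambda>(u, x). flow \<Gamma> u x)"
    using free_arcsD(1) cl on by (rule continuous_on_closed_Union)
  moreover have "continuous_on ({a..b} \<times> ?E) (\<lambda>(u, x). flow \<Gamma> u x)"
  proof (rule continuous_on_eq[of _ snd])
    show "continuous_on ({a..b} \<times> ?E) snd" by (intro continuous_on_snd continuous_on_id)
    show "snd p = (case p of (u, x) \<Rightarrow> flow \<Gamma> u x)" if "p \<in> {a..b} \<times> ?E" for p
      using that flow_off_arcs by (auto simp: case_prod_beta)
  qed
  moreover have "openin (top_of_set X) (\<Union>g\<in>\<Gamma>. g ` {0<..<1})" using free_arcsD(5) by blast
  then have "closedin (top_of_set X) ?E" by (metis closedin_diff closedin_topspace topspace_euclidean_subtopology)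
  then have "closed ({a..b} \<times> ?E)"
    using closedin_compact[OF X] by (intro compact_imp_closed compact_Times) auto
  moreover have "closed (\<Union>g\<in>\<Gamma>. {a..b} \<times> g ` {0..1})" using free_arcsD(1) cl by blast
  ultimately have "continuous_on ((\<Union>g\<in>\<Gamma>. {a..b} \<times> g ` {0..1}) \<union> {a..b} \<times> ?E) (\<lambda>(u, x). flow \<Gamma> u x)"
    by (intro continuous_on_closed_Un)
  then show ?thesis
  proof (rule continuous_on_subset)
    have "x \<in> (\<Union>g\<in>\<Gamma>. g ` {0..1}) \<union> ?E" if "x \<in> X" for x
    proof (cases "x \<in> (\<Union>g\<in>\<Gamma>. g ` {0<..<1})")
      case True
      then obtain g t where "g \<in> \<Gamma>" "t \<in> {0<..<1}" "x = g t" by blast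
      then have "x \<in> g ` {0..1}" by auto
      then show ?thesis using \<open>g \<in> \<Gamma>\<close> by blast
    qed (use that in blast)
    then show "{a..b} \<times> X \<subseteq> (\<Union>g\<in>\<Gamma>. {a..b} \<times> g ` {0..1}) \<union> {a..b} \<times> ?E" by blast
  qed
qed

lemma homeomorphism_flow:
  assumes X: "compact X" and u: "0 < u"
  shows "homeomorphism X X (flow \<Gamma> u) (flow \<Gamma> (1/u))"
proof -
  have cont: "continuous_on X (flow \<Gamma> v)" if "0 < v" for v
    using continuous_on_compose2[OF continuous_on_flow[OF X that, of v], of X "\<lambda>x. (v, x)"]
    by (force simp: continuous_on_Pair)
  show ?thesis
    unfolding homeomorphism_def
  proof (intro conjI ballI)
    show "continuous_on X (flow \<Gamma> u)" "continuous_on X (flow \<Gamma> (1/u))" using cont u by auto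
    show "flow \<Gamma> u ` X = X"
      using flow_in[OF _ u] flow_in[of _ "1/u"] flow_inverse(2)[OF _ u] u by (force simp: image_iff)
    show "flow \<Gamma> (1/u) ` X = X"
      using flow_in[OF _ u] flow_in[of _ "1/u"] flow_inverse(1)[OF _ u] u by (force simp: image_iff)
  qed (use flow_inverse u in auto)
qed

lemma flow_subcontinuum:
  assumes X: "compact X" and u: "0 < u" and B: "B \<in> subcontinua X"
  shows "flow \<Gamma> u ` B \<in> subcontinua X"
proof -
  have BX: "B \<subseteq> X" using B closedin_imp_subset by (auto simp: subcontinua_def)
  have cont: "continuous_on B (flow \<Gamma> u)"
    using homeomorphism_cont1[OF homeomorphism_flow[OF X u]] BX by (rule continuous_on_subset)
  have "compact (flow \<Gamma> u ` B)"
    using cont subcontinua_compact(1)[OF X B] by (rule compact_continuous_image)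
  moreover have "flow \<Gamma> u ` B \<subseteq> X" using BX flow_in u by blast
  ultimately have "closedin (top_of_set X) (flow \<Gamma> u ` B)" 
    using closed_subset compact_imp_closed by blast
  moreover have "connected (flow \<Gamma> u ` B)"
    using cont B by (intro connected_continuous_image) (auto simp: subcontinua_def)
  ultimately show ?thesis using B by (auto simp: subcontinua_def)
qed

lemma flow_NC_star:
  assumes X: "compact X" and u: "0 < u" and B: "B \<in> NC_star X"
  shows "flow \<Gamma> u ` B \<in> NC_star X"
proof -
  have B': "B \<in> subcontinua X" "connected (X - B)" using B by (auto simp: NC_star_def)
  have BX: "B \<subseteq> X" using B' closedin_imp_subset by (auto simp: subcontinua_def)
  note h = homeomorphism_flow[OF X u]
  have "connected (flow \<Gamma> u ` (X - B))"
    using continuous_on_subset[OF homeomorphism_cont1[OF h]] B'(2)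
    by (intro connected_continuous_image) auto
  moreover have "inj_on (flow \<Gamma> u) X"
    by (rule inj_on_inverseI[of _ "flow \<Gamma> (1/u)"]) (use homeomorphism_apply1[OF h] in simp)
  then have "flow \<Gamma> u ` (X - B) = X - flow \<Gamma> u ` B"
    using homeomorphism_image1[OF h] BX inj_on_image_set_diff[of "flow \<Gamma> u" X X B] by simp
  ultimately show ?thesis using flow_subcontinuum[OF X u B'(1)] by (simp add: NC_star_def)
qed

lemma continuous_map_flow:
  assumes X: "compact X" and B: "B \<in> subcontinua X"
  shows "continuous_map (top_of_set {1..}) (subcontinua_topology X) (\<lambda>u. flow \<Gamma> u ` B)"
proof -
  interpret H: Metric_space "subcontinua X" hausdorff_dist by (rule Metric_space_subcontinua[OF X])
  have BX: "B \<subseteq> X" using B closedin_imp_subset by (auto simp: subcontinua_def)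
  show ?thesis
    unfolding subcontinua_topology_def H.continuous_map_to_metric
  proof (intro ballI allI impI)
    fix u :: real and e :: real assume "u \<in> topspace (top_of_set {1..})" and e: "0 < e"
    then have u: "1 \<le> u" by simp
    have "uniformly_continuous_on ({1..u+1} \<times> X) (\<lambda>(u, x). flow \<Gamma> u x)"
      using continuous_on_flow[OF X, of 1 "u+1"] X
      by (intro compact_uniformly_continuous compact_Times) auto
    then obtain d where d: "0 < d" "\<And>p q. p \<in> {1..u+1} \<times> X \<Longrightarrow> q \<in> {1..u+1} \<times> X \<Longrightarrow> dist q p < d \<Longrightarrow>
        dist ((\<lambda>(u, x). flow \<Gamma> u x) q) ((\<lambda>(u, x). flow \<Gamma> u x) p) < e/2"
      using e unfolding uniformly_continuous_on_def by (metis half_gt_zero)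
    let ?U = "{1..} \<inter> ball u (min d 1)"
    have "flow \<Gamma> v ` B \<in> H.mball (flow \<Gamma> u ` B) e" if v: "v \<in> ?U" for v
    proof -
      have v': "v \<in> {1..u+1}" "dist v u < d" using v by (auto simp: dist_real_def)
      have close: "dist (flow \<Gamma> u x) (flow \<Gamma> v x) < e/2" if "x \<in> B" for x
        using d(2)[of "(v, x)" "(u, x)"] v' that BX u by (auto simp: dist_Pair_Pair dist_commute)
      have sub: "flow \<Gamma> u ` B \<in> subcontinua X" "flow \<Gamma> v ` B \<in> subcontinua X"
        using flow_subcontinuum[OF X _ B] u v' by auto
      have "hausdorff_dist (flow \<Gamma> u ` B) (flow \<Gamma> v ` B) < e"
        by (rule hausdorff_dist_lessI[OF X sub, of "e/2"]) (use e close in auto)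
      then show ?thesis using sub by simp
    qed
    moreover have "openin (top_of_set {1..}) ?U" by (simp add: openin_open_Int)
    moreover have "u \<in> ?U" using u d(1) by simp
    ultimately show "\<exists>U. openin (top_of_set {1..}) U \<and> u \<in> U \<and>
        (\<forall>v\<in>U. flow \<Gamma> v ` B \<in> H.mball (flow \<Gamma> u ` B) e)" by blast
  qed
qed

end

section \<open>The orbit of a nearby subcontinuum\<close>

text \<open>
  The condition that each leg lies in A or avoids A makes the flow along the legs preserve A. The
  disjoint balls keep the stars apart.
\<close>

definition star_family :: "'a::metric_space set \<Rightarrow> 'a set \<Rightarrow> real \<Rightarrow> 'a set \<Rightarrow> ('a \<Rightarrow> (real \<Rightarrow> 'a) set) \<Rightarrow> bool"
  where
  "star_family X A e P G \<longleftrightarrow> finite P \<and> P \<subseteq> A \<and> 0 < e \<and>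
     (\<forall>p\<in>P. \<forall>q\<in>P. p \<noteq> q \<longrightarrow> ball p e \<inter> ball q e = {}) \<and>
     (\<forall>p\<in>P. star_at X p (G p) \<and>
        (\<forall>g\<in>G p. g ` {0..1} \<subseteq> ball p e \<and> (g ` {0<..1} \<subseteq> A \<or> g ` {0<..1} \<inter> A = {})))"

context
  fixes X A P :: "'a::metric_space set" and e :: real and G :: "'a \<Rightarrow> (real \<Rightarrow> 'a) set"
  assumes fam: "star_family X A e P G"
begin

lemma star_familyD:
  shows "finite P" "P \<subseteq> A" "0 < e"
    and "p \<in> P \<Longrightarrow> q \<in> P \<Longrightarrow> p \<noteq> q \<Longrightarrow> ball p e \<inter> ball q e = {}"
    and "p \<in> P \<Longrightarrow> star_at X p (G p)"
    and "p \<in> P \<Longrightarrow> g \<in> G p \<Longrightarrow> g ` {0..1} \<subseteq> ball p e"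
    and "p \<in> P \<Longrightarrow> g \<in> G p \<Longrightarrow> g ` {0<..1} \<subseteq> A \<or> g ` {0<..1} \<inter> A = {}"
  using fam by (simp_all add: star_family_def)

lemma open_star_in_ball:
  assumes "p \<in> P" "c \<le> 1"
  shows "open_star p (G p) c \<subseteq> ball p e"
proof -
  have "g ` {0..<c} \<subseteq> ball p e" if "g \<in> G p" for g
  proof -
    have "g ` {0..<c} \<subseteq> g ` {0..1}" using assms(2) by (intro image_mono) auto
    then show ?thesis using star_familyD(6)[OF assms(1) that] by (rule order_trans)
  qed
  moreover have "p \<in> ball p e" using star_familyD(3) by simp
  ultimately show ?thesis unfolding open_star_def by blast
qed

lemma free_arcs_star_family: "free_arcs X (\<Union>p\<in>P. G p)"
  unfolding free_arcs_def
proof (intro conjI ballI impI)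
  show "finite (\<Union>p\<in>P. G p)" using star_familyD(1,5) by (auto simp: star_at_def)
next
  fix g assume "g \<in> (\<Union>p\<in>P. G p)"
  then obtain p where p: "p \<in> P" "g \<in> G p" by blast
  note st = star_familyD(5)[OF p(1)]
  show "continuous_on {0..1} g" "inj_on g {0..1}" "g ` {0..1} \<subseteq> X"
    using star_at_leg[OF st p(2)] by auto
  show "openin (top_of_set X) (g ` {0<..<1})" using openin_open_leg[OF st p(2)] by simp
  fix h assume "h \<in> (\<Union>p\<in>P. G p)" and "g \<noteq> h"
  then obtain q where q: "q \<in> P" "h \<in> G q" by blast
  show "g ` {0<..<1} \<inter> h ` {0..1} = {}"
  proof (cases "p = q")
    case True
    then show ?thesis using star_at_disjoint[OF st p(2)] q \<open>g \<noteq> h\<close> by simp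
  next
    case False
    have "g ` {0<..<1} \<subseteq> g ` {0..1}" by (intro image_mono) auto
    then have "g ` {0<..<1} \<subseteq> ball p e" using star_familyD(6)[OF p] by (rule order_trans)
    then show ?thesis using star_familyD(4)[OF p(1) q(1) False] star_familyD(6)[OF q] by blast
  qed
qed

abbreviation "star_flow \<equiv> flow (\<Union>p\<in>P. G p)"

text \<open>
  For c < 1 the new parameter bound c powr u tends to 0 as u grows: the star contracts to p.
\<close>

lemma flow_open_star:
  assumes p: "p \<in> P" and x: "x \<in> open_star p (G p) c" and c: "c \<le> 1" and u: "0 < u"
  shows "star_flow u x \<in> open_star p (G p) (c powr u)"
proof (cases "x = p")
  case True
  have "p \<notin> g ` {0<..<1}" if "q \<in> P" "g \<in> G q" for g q
  proof (cases "p = q")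
    case True
    then show ?thesis using star_at_center[OF star_familyD(5)[OF that(1)] that(2)] by fastforce
  next
    case False
    have "g ` {0<..<1} \<subseteq> g ` {0..1}" by (intro image_mono) auto
    then have "g ` {0<..<1} \<subseteq> ball q e" using star_familyD(6)[OF that] by (rule order_trans)
    moreover have "p \<in> ball p e" using star_familyD(3) by simp
    ultimately show ?thesis using star_familyD(4)[OF p that(1) False] by blast
  qed
  then have "star_flow u p = p" by (intro flow_off_arcs[OF free_arcs_star_family]) blast
  then show ?thesis using True by (simp add: open_star_def)
next
  case False
  then obtain g s where g: "g \<in> G p" "s \<in> {0..<c}" "x = g s" using x unfolding open_star_def by blast
  have "s powr u < c powr u" using g(2) u by (intro powr_less_mono2) auto
  moreover have "star_flow u x = g (s powr u)"
    unfolding g(3) using g(1,2) p c u by (intro flow_on_arc[OF free_arcs_star_family]) auto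
  ultimately have "star_flow u x \<in> g ` {0..<c powr u}" by simp
  then show ?thesis using g(1) unfolding open_star_def by blast
qed

lemma flow_preserves:
  assumes AX: "A \<subseteq> X" and u: "0 < u"
  shows "star_flow u ` A = A"
proof -
  note fa = free_arcs_star_family
  have in_A: "star_flow v x \<in> A" if x: "x \<in> A" and v: "0 < v" for v x
  proof (cases "x \<in> (\<Union>g\<in>(\<Union>p\<in>P. G p). g ` {0<..<1})")
    case False
    then show ?thesis using flow_off_arcs[OF fa] x by simp
  next
    case True
    then obtain p g s where g: "p \<in> P" "g \<in> G p" "s \<in> {0<..<1}" "x = g s" by blast
    then have "x \<in> g ` {0<..1}" by auto
    then have gA: "g ` {0<..1} \<subseteq> A" using star_familyD(7)[OF g(1,2)] x by blast
    have "star_flow v x = g (s powr v)" unfolding g(4) using g v by (intro flow_on_arc[OF fa]) auto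
    moreover have "s powr v \<in> {0<..1}" using g(3) v powr_unit[of s v] by (auto simp: powr_unit)
    ultimately show ?thesis using gA by auto
  qed
  have "x \<in> star_flow u ` A" if "x \<in> A" for x
    using flow_inverse(2)[OF fa, of x u] in_A[OF that, of "1/u"] that AX u by (metis imageI subsetD zero_less_divide_1_iff)
  then show ?thesis using in_A u by blast
qed

text \<open>
  Applying the flow to A and B changes A not at all and moves all points where the two sets differ
  into the small stars. A point of A there is compared with the image of a point of B in the same
  star, a point of the image of B with the centre, which belongs to A.
\<close>

lemma hausdorff_dist_flow:
  assumes X: "compact X" and A: "A \<in> subcontinua X" and B: "B \<in> subcontinua X"
    and diff: "(A - B) \<union> (B - A) \<subseteq> (\<Union>p\<in>P. open_star p (G p) c)"
    and meets: "\<And>p. p \<in> P \<Longrightarrow> B \<inter> open_star p (G p) c \<noteq> {}"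
    and c: "c \<le> 1" and u: "0 < u"
    and small: "\<And>p. p \<in> P \<Longrightarrow> open_star p (G p) (c powr u) \<subseteq> ball p \<eta>"
    and \<eta>: "0 < \<eta>" "2 * \<eta> < r"
  shows "hausdorff_dist A (star_flow u ` B) < r"
proof -
  have AX: "A \<subseteq> X" using A closedin_imp_subset by (auto simp: subcontinua_def)
  note HA = flow_preserves[OF AX u]
  have near: "dist p (star_flow u x) < \<eta>" if "p \<in> P" "x \<in> open_star p (G p) c" for p x
    using flow_open_star[OF that c u] small[OF that(1)] by auto
  show ?thesis
  proof (rule hausdorff_dist_lessI[OF X A flow_subcontinuum[OF free_arcs_star_family X u B]])
    show "0 < 2 * \<eta>" "2 * \<eta> < r" using \<eta> by auto
    show "\<exists>b\<in>star_flow u ` B. dist a b < 2 * \<eta>" if "a \<in> A" for a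
    proof -
      obtain a' where a': "a' \<in> A" "a = star_flow u a'" using HA \<open>a \<in> A\<close> by blast
      show ?thesis
      proof (cases "a' \<in> B")
        case True
        then show ?thesis using a'(2) \<eta> by (intro bexI[of _ a]) auto
      next
        case False
        then obtain p where p: "p \<in> P" "a' \<in> open_star p (G p) c" using diff a'(1) by blast
        obtain b where b: "b \<in> B" "b \<in> open_star p (G p) c" using meets[OF p(1)] by blast
        have "dist a (star_flow u b) < 2 * \<eta>"
          using near[OF p] near[OF p(1) b(2)] dist_triangle3[of a "star_flow u b" p] unfolding a'(2) by linarith
        then show ?thesis using b(1) by blast
      qed
    qed
    show "\<exists>a\<in>A. dist a b < 2 * \<eta>" if "b \<in> star_flow u ` B" for b
    proof -
      obtain b' where b': "b' \<in> B" "b = star_flow u b'" using \<open>b \<in> star_flow u ` B\<close> by blast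
      show ?thesis
      proof (cases "b' \<in> A")
        case True
        then have "b \<in> A" using HA b'(2) by blast
        then show ?thesis using \<eta> by (intro bexI[of _ b]) auto
      next
        case False
        then obtain p where p: "p \<in> P" "b' \<in> open_star p (G p) c" using diff b'(1) by blast
        have "dist p b < 2 * \<eta>" using near[OF p] b'(2) \<eta> by simp
        then show ?thesis using p(1) star_familyD(2) by blast
      qed
    qed
  qed
qed

lemma stars_shrink:
  assumes c: "0 < c" "c < 1" and \<eta>: "0 < \<eta>"
  shows "\<exists>u\<ge>1. \<forall>p\<in>P. open_star p (G p) (c powr u) \<subseteq> ball p \<eta>"
proof -
  have "\<exists>d>0. \<forall>t\<in>{0..1}. t < d \<longrightarrow> dist (g 0) (g t) < \<eta>" if "g \<in> (\<Union>p\<in>P. G p)" for g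
  proof -
    have "continuous_on {0..1} g" using free_arcsD(2)[OF free_arcs_star_family that] .
    moreover have "(0::real) \<in> {0..1}" by simp
    ultimately obtain d where "0 < d" "\<forall>t\<in>{0..1}. dist t 0 < d \<longrightarrow> dist (g t) (g 0) < \<eta>"
      using \<eta> unfolding continuous_on_iff by blast
    then show ?thesis by (intro exI[of _ d]) (auto simp: dist_commute)
  qed
  then obtain d where d: "\<And>g. g \<in> (\<Union>p\<in>P. G p) \<Longrightarrow> 0 < d g \<and> (\<forall>t\<in>{0..1}. t < d g \<longrightarrow> dist (g 0) (g t) < \<eta>)"
    by metis
  let ?m = "Min (insert 1 (d ` (\<Union>p\<in>P. G p)))"
  have fin: "finite (insert 1 (d ` (\<Union>p\<in>P. G p)))" using free_arcsD(1)[OF free_arcs_star_family] by simp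
  have "0 < ?m" using fin d by (subst Min_gr_iff) auto
  then obtain n where n: "c ^ n < ?m" using real_arch_pow_inv c(2) by blast
  let ?u = "real (Suc n)"
  have "c powr ?u = c ^ Suc n" using c powr_realpow by blast
  also have "\<dots> \<le> c ^ n" using c by simp
  finally have cu: "c powr ?u < ?m" using n by linarith
  have "open_star p (G p) (c powr ?u) \<subseteq> ball p \<eta>" if p: "p \<in> P" for p
  proof
    fix x assume x: "x \<in> open_star p (G p) (c powr ?u)"
    show "x \<in> ball p \<eta>"
    proof (cases "x = p")
      case False
      then obtain g t where g: "g \<in> G p" "t \<in> {0..<c powr ?u}" "x = g t"
        using x unfolding open_star_def by blast
      then have gP: "g \<in> (\<Union>p\<in>P. G p)" using p by blast
      have "?m \<le> d g" using gP by (intro Min_le[OF fin]) blast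
      moreover have "?m \<le> 1" by (intro Min_le[OF fin]) blast
      ultimately have "t \<in> {0..1}" "t < d g" using g(2) cu by auto
      then have "dist (g 0) (g t) < \<eta>" using d[OF gP] by blast
      then show ?thesis using star_at_leg(4)[OF star_familyD(5)[OF p] g(1)] g(3) by simp
    qed (use \<eta> in simp)
  qed
  then show ?thesis by (intro exI[of _ ?u]) auto
qed

text \<open>
  The orbit starts in B at u = 1 and is the continuous image of a half-line. Adding the limit A,
  a point of its closure, keeps it connected. The bound on the distance comes from the stars being
  contained in balls of radius e around points of A.
\<close>

lemma flow_orbit_connected:
  assumes X: "compact X" and A: "A \<in> NC_star X" and B: "B \<in> NC_star X"
    and diff: "(A - B) \<union> (B - A) \<subseteq> (\<Union>p\<in>P. open_star p (G p) c)"
    and meets: "\<And>p. p \<in> P \<Longrightarrow> B \<inter> open_star p (G p) c \<noteq> {}"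
    and c: "0 < c" "c < 1" and r: "2 * e < r"
  shows "\<exists>\<C>. connectedin (subtopology (subcontinua_topology X) (NC_star X)) \<C> \<and>
    A \<in> \<C> \<and> B \<in> \<C> \<and> (\<forall>D\<in>\<C>. hausdorff_dist A D < r)"
proof -
  interpret M: Metric_space "subcontinua X" hausdorff_dist by (rule Metric_space_subcontinua[OF X])
  note fa = free_arcs_star_family
  have A': "A \<in> subcontinua X" and B': "B \<in> subcontinua X" using A B by (auto simp: NC_star_def)
  have BX: "B \<subseteq> X" using B' closedin_imp_subset by (auto simp: subcontinua_def)
  define \<S> where "\<S> = (\<lambda>u. star_flow u ` B) ` {1..}"
  have "connectedin (top_of_set {1..}) {1::real..}" by (simp add: connectedin_subtopology)
  then have "connectedin (subcontinua_topology X) \<S>"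
    unfolding \<S>_def by (rule connectedin_continuous_map_image[OF continuous_map_flow[OF fa X B']])
  moreover have "A \<in> subcontinua_topology X closure_of \<S>"
    unfolding subcontinua_topology_def M.metric_closure_of
  proof (intro CollectI conjI allI impI)
    show "A \<in> subcontinua X" by (rule A')
    fix \<epsilon> :: real assume "0 < \<epsilon>"
    then obtain u where u: "1 \<le> u" "\<And>p. p \<in> P \<Longrightarrow> open_star p (G p) (c powr u) \<subseteq> ball p (\<epsilon>/3)"
      using stars_shrink[OF c, of "\<epsilon>/3"] by auto
    have "hausdorff_dist A (star_flow u ` B) < \<epsilon>"
      by (rule hausdorff_dist_flow[OF X A' B' diff meets _ _ u(2)]) (use c u(1) \<open>0 < \<epsilon>\<close> in auto)
    moreover have "star_flow u ` B \<in> subcontinua X" using flow_subcontinuum[OF fa X _ B'] u(1) by simp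
    ultimately show "\<exists>D\<in>\<S>. D \<in> M.mball A \<epsilon>" using A' u(1) by (auto simp: \<S>_def)
  qed
  moreover have "\<S> \<subseteq> topspace (subcontinua_topology X)"
    using calculation(1) connectedin_subset_topspace by blast
  then have "\<S> \<subseteq> subcontinua_topology X closure_of \<S>" by (rule closure_of_subset)
  ultimately have "connectedin (subcontinua_topology X) (insert A \<S>)"
    using connectedin_intermediate_closure_of[of _ \<S> "insert A \<S>"] by blast
  moreover have "star_flow u ` B \<in> NC_star X" if "1 \<le> u" for u
    using flow_NC_star[OF fa X _ B] that by simp
  then have "insert A \<S> \<subseteq> NC_star X" using A by (auto simp: \<S>_def)
  ultimately have "connectedin (subtopology (subcontinua_topology X) (NC_star X)) (insert A \<S>)"
    by (simp add: connectedin_subtopology)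
  moreover have "star_flow 1 ` B = B" using flow_one[OF fa] BX by (auto simp: image_iff subset_iff)
  then have "B \<in> \<S>" unfolding \<S>_def by (intro image_eqI[of _ _ 1]) auto
  moreover have "hausdorff_dist A (star_flow u ` B) < r" if u: "1 \<le> u" for u
  proof (rule hausdorff_dist_flow[OF X A' B' diff meets])
    fix p assume p: "p \<in> P"
    have "c powr u \<le> 1" using powr_unit[of c u] c u by simp
    then show "open_star p (G p) (c powr u) \<subseteq> ball p e" by (rule open_star_in_ball[OF p])
  qed (use c u r star_familyD(3) in auto)
  moreover have "hausdorff_dist A A < r"
    using M.mdist_zero[OF A'] r star_familyD(3) by simp
  ultimately show ?thesis by (intro exI[of _ "insert A \<S>"]) (auto simp: \<S>_def)
qed

end

section \<open>Subcontinua near A\<close>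

lemma finite_subcover_openin:
  assumes K: "compact K" "K \<subseteq> X" and N: "\<And>x. x \<in> K \<Longrightarrow> openin (top_of_set X) (N x) \<and> x \<in> N x"
  shows "\<exists>Q\<subseteq>K. finite Q \<and> K \<subseteq> (\<Union>x\<in>Q. N x)"
proof -
  have "\<forall>x\<in>K. \<exists>V. open V \<and> N x = X \<inter> V" using N unfolding openin_open by blast
  then obtain V where V: "\<And>x. x \<in> K \<Longrightarrow> open (V x) \<and> N x = X \<inter> V x" by metis
  have "K \<subseteq> (\<Union>x\<in>K. V x)" using N V by blast
  then obtain Q where "Q \<subseteq> K" "finite Q" "K \<subseteq> (\<Union>x\<in>Q. V x)"
    using compactE_image[OF K(1), of K V] V by blast
  then have "K \<subseteq> (\<Union>x\<in>Q. N x)" using V K(2) by blast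
  then show ?thesis using \<open>Q \<subseteq> K\<close> \<open>finite Q\<close> by blast
qed

text \<open>
  Each leg without its ends is open in X, so its points are interior to A or outside A.
\<close>

lemma homogeneous_star_frontier:
  assumes st: "star_at X p G" and hom: "\<And>g. g \<in> G \<Longrightarrow> g ` {0<..1} \<subseteq> A \<or> g ` {0<..1} \<inter> A = {}"
  shows "A \<inter> closure (X - A) \<inter> open_star p G 1 \<subseteq> {p}"
proof
  fix x assume x: "x \<in> A \<inter> closure (X - A) \<inter> open_star p G 1"
  show "x \<in> {p}"
  proof (rule ccontr)
    assume "x \<notin> {p}"
    then obtain g t where g: "g \<in> G" "t \<in> {0..<1}" "x = g t" using x unfolding open_star_def by blast
    then have "t \<noteq> 0" using star_at_leg(4)[OF st g(1)] \<open>x \<notin> {p}\<close> by auto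
    then have t: "t \<in> {0<..<1}" using g(2) by auto
    then have "x \<in> g ` {0<..1}" using g(3) by auto
    then have gA: "g ` {0<..1} \<subseteq> A" using hom[OF g(1)] x by blast
    have "openin (top_of_set X) (g ` {0<..<1})" using openin_open_leg[OF st g(1)] by simp
    then obtain V where V: "open V" "g ` {0<..<1} = X \<inter> V" unfolding openin_open by blast
    moreover have "g ` {0<..<1} \<subseteq> g ` {0<..1}" by (intro image_mono) auto
    ultimately have "V \<inter> (X - A) = {}" using gA by blast
    then have "V \<inter> closure (X - A) = {}" using open_Int_closure_eq_empty[OF V(1)] by blast
    moreover have "x \<in> V" using V(2) t g(3) by blast
    ultimately show False using x by blast
  qed
qed

lemma finite_frontier:
  assumes X: "finite_graph X" and A: "connected A" "A \<subseteq> X"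
  shows "finite (A \<inter> closure (X - A))"
proof -
  have cX: "compact X" using X by (simp add: finite_graph_def continuum_def)
  have "\<forall>q\<in>X. \<exists>G. star_at X q G \<and> (\<forall>g\<in>G. g ` {0<..1} \<subseteq> A \<or> g ` {0<..1} \<inter> A = {})"
    using small_homogeneous_star[OF X _ A zero_less_one] by meson
  then obtain G where G: "\<And>q. q \<in> X \<Longrightarrow> star_at X q (G q)"
    "\<And>q g. q \<in> X \<Longrightarrow> g \<in> G q \<Longrightarrow> g ` {0<..1} \<subseteq> A \<or> g ` {0<..1} \<inter> A = {}" by metis
  have "openin (top_of_set X) (open_star q (G q) 1) \<and> q \<in> open_star q (G q) 1" if "q \<in> X" for q
    using openin_open_star[OF G(1)[OF that]] by (simp add: open_star_def)
  then obtain Q where Q: "Q \<subseteq> X" "finite Q" "X \<subseteq> (\<Union>q\<in>Q. open_star q (G q) 1)"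
    using finite_subcover_openin[OF cX order_refl, of "\<lambda>q. open_star q (G q) 1"] by blast
  have "A \<inter> closure (X - A) \<subseteq> Q"
  proof
    fix x assume x: "x \<in> A \<inter> closure (X - A)"
    then obtain q where q: "q \<in> Q" "x \<in> open_star q (G q) 1" using Q(3) A(2) by blast
    then have "q \<in> X" using Q(1) by blast
    then have "A \<inter> closure (X - A) \<inter> open_star q (G q) 1 \<subseteq> {q}"
      by (intro homogeneous_star_frontier[OF G(1) G(2)])
    then have "x = q" using x q(2) by blast
    then show "x \<in> Q" using q(1) by simp
  qed
  then show ?thesis using Q(2) finite_subset by blast
qed

lemma finite_disjoint_balls:
  fixes P :: "'a::metric_space set"
  assumes "finite P" "0 < e"
  shows "\<exists>r. 0 < r \<and> r \<le> e \<and> (\<forall>p\<in>P. \<forall>q\<in>P. p \<noteq> q \<longrightarrow> ball p r \<inter> ball q r = {})"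
proof -
  obtain d where d: "\<And>p. 0 < d p \<and> (\<forall>q\<in>P. q \<noteq> p \<longrightarrow> d p \<le> dist p q)"
    using finite_set_avoid[OF assms(1)] by metis
  define r where "r = Min (insert e ((\<lambda>p. d p / 2) ` P))"
  have fin: "finite (insert e ((\<lambda>p. d p / 2) ` P))" using assms(1) by simp
  have "0 < r" unfolding r_def using fin d assms(2) by (subst Min_gr_iff) auto
  moreover have "r \<le> e" unfolding r_def by (intro Min_le[OF fin]) simp
  moreover have "ball p r \<inter> ball q r = {}" if pq: "p \<in> P" "q \<in> P" "p \<noteq> q" for p q
  proof -
    have "r \<le> d p / 2" unfolding r_def using pq(1) by (intro Min_le[OF fin]) blast
    then have "2 * r \<le> dist p q" using d[of p] pq by fastforce
    then have False if "x \<in> ball p r \<inter> ball q r" for x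
      using that dist_triangle2[of p q x] by simp
    then show ?thesis by blast
  qed
  ultimately show ?thesis by blast
qed

text \<open>
  Here P is the frontier of A, S the union of its stars cut at parameter 1/2, and K the rest of A,
  which is a compact subset of the interior of A and is covered by finitely many stars inside A. A
  neighbourhood of A in the hyperspace is described by three kinds of conditions on B: B stays in
  the union of A and S, it meets all of the half stars, and it meets the outer half of every leg of
  the stars that cover K. The last condition sets up the barriers of \<open>star_barrier\<close>.
\<close>

lemma NC_star_nearby:
  assumes X: "finite_graph X" and A: "A \<in> NC_star X" and e: "0 < e"
  shows "\<exists>\<U>. openin (subcontinua_topology X) \<U> \<and> A \<in> \<U> \<and>
    (\<forall>B\<in>\<U> \<inter> NC_star X. \<exists>P G r c. star_family X A r P G \<and> r \<le> e \<and> 0 < c \<and> c < 1 \<and>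
       (A - B) \<union> (B - A) \<subseteq> (\<Union>p\<in>P. open_star p (G p) c) \<and>
       (\<forall>p\<in>P. B \<inter> open_star p (G p) c \<noteq> {}))"
proof -
  have cX: "compact X" using X by (simp add: finite_graph_def continuum_def)
  have A': "A \<in> subcontinua X" using A by (simp add: NC_star_def)
  have AX: "A \<subseteq> X" using A' closedin_imp_subset by (auto simp: subcontinua_def)
  have cA: "compact A" "connected A" using subcontinua_compact[OF cX A'] A' by (auto simp: subcontinua_def)
  note stars = small_homogeneous_star[OF X _ cA(2) AX]
  define P where "P = A \<inter> closure (X - A)"
  have finP: "finite P" unfolding P_def by (rule finite_frontier[OF X cA(2) AX])
  obtain r where r: "0 < r" "r \<le> e" "\<And>p q. p \<in> P \<Longrightarrow> q \<in> P \<Longrightarrow> p \<noteq> q \<Longrightarrow> ball p r \<inter> ball q r = {}"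
    using finite_disjoint_balls[OF finP e] by blast
  have PA: "P \<subseteq> A" by (simp add: P_def)
  have "\<forall>p\<in>P. \<exists>G. star_at X p G \<and>
      (\<forall>g\<in>G. g ` {0..1} \<subseteq> ball p r \<and> (g ` {0<..1} \<subseteq> A \<or> g ` {0<..1} \<inter> A = {}))"
    using stars[OF _ r(1)] PA AX by blast
  then obtain G where G: "\<And>p. p \<in> P \<Longrightarrow> star_at X p (G p) \<and>
      (\<forall>g\<in>G p. g ` {0..1} \<subseteq> ball p r \<and> (g ` {0<..1} \<subseteq> A \<or> g ` {0<..1} \<inter> A = {}))" by metis
  have fam: "star_family X A r P G" unfolding star_family_def using finP PA r G by simp
  define S where "S = (\<Union>p\<in>P. open_star p (G p) (1/2))"
  have oG: "openin (top_of_set X) (open_star p (G p) (1/2))" if "p \<in> P" for p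
    by (rule openin_open_star) (use G[OF that] in auto)
  then have oS: "openin (top_of_set X) S" unfolding S_def by blast
  have PS: "P \<subseteq> S" by (auto simp: S_def open_star_def)
  define V where "V = X - closure (X - A)"
  have oV: "openin (top_of_set X) V" unfolding V_def by (simp add: Diff_eq openin_open_Int open_Compl)
  have VA: "V \<subseteq> A" unfolding V_def using closure_subset[of "X - A"] by blast
  have AVS: "A \<union> S = V \<union> S" using VA PS AX by (auto simp: V_def P_def)
  define K where "K = A - S"
  have KV: "K \<subseteq> V" using AVS by (auto simp: K_def)
  have cK: "compact K"
  proof -
    obtain T where "open T" "S = X \<inter> T" using oS unfolding openin_open by blast
    then have "K = A \<inter> - T" using AX by (auto simp: K_def)
    then show ?thesis using compact_Int_closed[OF cA(1)] \<open>open T\<close> by (simp add: closed_Compl)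
  qed
  have "\<exists>L. star_at X q L \<and>
      (\<forall>g\<in>L. g ` {0..1} \<subseteq> ball q r \<and> g ` {0..1} \<subseteq> A \<and> (g ` {0<..1} \<subseteq> A \<or> g ` {0<..1} \<inter> A = {}))"
    if q: "q \<in> K" for q
  proof -
    have qX: "q \<in> X" using q AX by (auto simp: K_def)
    obtain T where T: "open T" "V = X \<inter> T" using oV unfolding openin_open by blast
    then have "q \<in> T" using q KV by blast
    then obtain s where s: "0 < s" "ball q s \<subseteq> T" using T(1) open_contains_ball by blast
    obtain L where L: "star_at X q L" "\<And>g. g \<in> L \<Longrightarrow> g ` {0..1} \<subseteq> ball q (min r s) \<and>
        (g ` {0<..1} \<subseteq> A \<or> g ` {0<..1} \<inter> A = {})"
      using stars[OF qX, of "min r s"] r(1) s(1) by auto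
    have "g ` {0..1} \<subseteq> ball q r \<and> g ` {0..1} \<subseteq> A" if g: "g \<in> L" for g
    proof -
      have gb: "g ` {0..1} \<subseteq> ball q r \<inter> ball q s" using L(2)[OF g] by (auto simp: subset_iff)
      moreover have "g ` {0..1} \<subseteq> X" using star_at_leg(3)[OF L(1) g] .
      ultimately have "g ` {0..1} \<subseteq> V" using T(2) s(2) by blast
      then show ?thesis using gb VA by blast
    qed
    then show ?thesis using L by blast
  qed
  then have "\<forall>q\<in>K. \<exists>L. star_at X q L \<and>
      (\<forall>g\<in>L. g ` {0..1} \<subseteq> ball q r \<and> g ` {0..1} \<subseteq> A \<and> (g ` {0<..1} \<subseteq> A \<or> g ` {0<..1} \<inter> A = {}))"
    by blast
  then obtain L where L': "\<And>q. q \<in> K \<Longrightarrow> star_at X q (L q) \<and>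
      (\<forall>g\<in>L q. g ` {0..1} \<subseteq> ball q r \<and> g ` {0..1} \<subseteq> A \<and> (g ` {0<..1} \<subseteq> A \<or> g ` {0<..1} \<inter> A = {}))"
    by metis
  have L: "star_at X q (L q)" "g \<in> L q \<Longrightarrow> g ` {0..1} \<subseteq> ball q r" "g \<in> L q \<Longrightarrow> g ` {0..1} \<subseteq> A"
    "g \<in> L q \<Longrightarrow> g ` {0<..1} \<subseteq> A \<or> g ` {0<..1} \<inter> A = {}" if "q \<in> K" for q g
    using L'[OF that] by simp_all
  have LA: "open_star q (L q) c \<subseteq> A" if "q \<in> K" "c \<le> 1" for q c
  proof -
    have "g ` {0..<c} \<subseteq> A" if "g \<in> L q" for g
    proof -
      have "g ` {0..<c} \<subseteq> g ` {0..1}" using \<open>c \<le> 1\<close> by (intro image_mono) auto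
      then show ?thesis using L(3)[OF \<open>q \<in> K\<close> that] by (rule order_trans)
    qed
    then show ?thesis using \<open>q \<in> K\<close> unfolding open_star_def K_def by blast
  qed
  have KX: "K \<subseteq> X" using AX by (auto simp: K_def)
  have "openin (top_of_set X) (open_star q (L q) (1/2)) \<and> q \<in> open_star q (L q) (1/2)" if "q \<in> K" for q
    using openin_open_star[OF L(1)[OF that]] by (simp add: open_star_def)
  then obtain Q where Q: "Q \<subseteq> K" "finite Q" "K \<subseteq> (\<Union>q\<in>Q. open_star q (L q) (1/2))"
    using finite_subcover_openin[OF cK KX, of "\<lambda>q. open_star q (L q) (1/2)"] by blast
  define \<O> where "\<O> = (\<lambda>p. open_star p (G p) (1/2)) ` P \<union> (\<lambda>q. open_star q (L q) (1/2)) ` Q \<union>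
      (\<Union>q\<in>Q. (\<lambda>g. g ` {1/2<..<1}) ` L q)"
  have fin\<O>: "finite \<O>"
    using finP Q L(1) by (auto simp: \<O>_def star_at_def)
  have \<O>_cases: "(\<exists>p\<in>P. U = open_star p (G p) (1/2)) \<or> (\<exists>q\<in>K. U = open_star q (L q) (1/2)) \<or>
      (\<exists>q\<in>K. \<exists>g\<in>L q. U = g ` {1/2<..<1})" if "U \<in> \<O>" for U
    using that Q(1) unfolding \<O>_def by blast
  have open\<O>: "openin (top_of_set X) U" if "U \<in> \<O>" for U
    using \<O>_cases[OF that]
  proof (elim disjE bexE)
    fix q assume q: "q \<in> K" "U = open_star q (L q) (1/2)"
    show ?thesis unfolding q(2) by (rule openin_open_star[OF L(1)[OF q(1)]]) auto
  next
    fix q g assume q: "q \<in> K" "g \<in> L q" "U = g ` {1/2<..<1}"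
    show ?thesis unfolding q(3) by (rule openin_open_leg[OF L(1)[OF q(1)] q(2)]) auto
  qed (use oG in simp)
  have meets\<O>: "A \<inter> U \<noteq> {}" if "U \<in> \<O>" for U
    using \<O>_cases[OF that]
  proof (elim disjE bexE)
    fix p assume "p \<in> P" "U = open_star p (G p) (1/2)"
    then show ?thesis using PA by (auto simp: open_star_def)
  next
    fix q assume "q \<in> K" "U = open_star q (L q) (1/2)"
    then show ?thesis by (auto simp: open_star_def K_def)
  next
    fix q g assume q: "q \<in> K" "g \<in> L q" "U = g ` {1/2<..<1}"
    have "g (3/4) \<in> g ` {0..1}" "g (3/4) \<in> U" using q(3) by auto
    then show ?thesis using L(3)[OF q(1,2)] by blast
  qed
  \<comment> \<open>A point outside A, if there is one, that nearby subcontinua have to avoid.\<close>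
  obtain Z where Z: "finite Z" "Z \<subseteq> X - A" "Z = {} \<Longrightarrow> A = X"
  proof (cases "A = X")
    case True
    then show ?thesis using that[of "{}"] by simp
  next
    case False
    then obtain u where "u \<in> X - A" using AX by blast
    then show ?thesis using that[of "{u}"] by simp
  qed
  define U where "U = (A \<union> S) - Z"
  have oU: "openin (top_of_set X) U"
    unfolding U_def AVS using oV oS Z(1) by (intro openin_minus_compact openin_Un finite_imp_compact)
  define \<U> where "\<U> = {B \<in> subcontinua X. B \<subseteq> U \<and> (\<forall>V\<in>\<O>. B \<inter> V \<noteq> {})}"
  have "openin (subcontinua_topology X) \<U>" unfolding \<U>_def by (rule openin_vietoris[OF cX oU fin\<O> open\<O>])
  moreover have "A \<in> \<U>" using A' meets\<O> Z(2) by (auto simp: \<U>_def U_def)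
  moreover have "\<exists>P G r c. star_family X A r P G \<and> r \<le> e \<and> 0 < c \<and> c < 1 \<and>
       (A - B) \<union> (B - A) \<subseteq> (\<Union>p\<in>P. open_star p (G p) c) \<and>
       (\<forall>p\<in>P. B \<inter> open_star p (G p) c \<noteq> {})" if B: "B \<in> \<U> \<inter> NC_star X" for B
  proof -
    have B': "B \<in> subcontinua X" "connected (X - B)" "B \<subseteq> U" "\<And>V. V \<in> \<O> \<Longrightarrow> B \<inter> V \<noteq> {}"
      using B by (auto simp: \<U>_def NC_star_def)
    have BX: "B \<subseteq> X" using B'(1) closedin_imp_subset by (auto simp: subcontinua_def)
    \<comment> \<open>A hole of B in K fills the whole complement of B, because B blocks the legs of the star around it.\<close>
    have hole: "\<exists>q\<in>Q. \<exists>c. 1/2 \<le> c \<and> c < 1 \<and> X - B \<subseteq> open_star q (L q) c" if x: "x \<in> K - B" for x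
    proof -
      obtain q where q: "q \<in> Q" "x \<in> open_star q (L q) (1/2)" using x Q(3) by blast
      have "\<exists>c. 1/2 \<le> c \<and> c < 1 \<and> X - B \<subseteq> open_star q (L q) c"
      proof (rule star_barrier[OF L(1)])
        show "q \<in> K" using q(1) Q(1) by blast
        show "B \<inter> g ` {1/2<..<1} \<noteq> {}" if "g \<in> L q" for g
          using that q(1) unfolding \<O>_def by (intro B'(4)[unfolded \<O>_def]) blast
        show "(X - B) \<inter> open_star q (L q) (1/2) \<noteq> {}" using x q(2) KX by blast
      qed (use B'(2) in auto)
      then show ?thesis using q(1) by blast
    qed
    show ?thesis
    proof (cases "K \<subseteq> B")
      case True
      have "(A - B) \<union> (B - A) \<subseteq> S" using True B'(3) by (auto simp: K_def U_def)
      moreover have "\<forall>p\<in>P. B \<inter> open_star p (G p) (1/2) \<noteq> {}" using B'(4) by (auto simp: \<O>_def)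
      ultimately show ?thesis
        using fam r(2) unfolding S_def by (intro exI[of _ P] exI[of _ G] exI[of _ r] exI[of _ "1/2"]) simp
    next
      case False
      then obtain q c where q: "q \<in> Q" "1/2 \<le> c" "c < 1" "X - B \<subseteq> open_star q (L q) c" using hole by blast
      have qK: "q \<in> K" using q(1) Q(1) by blast
      \<comment> \<open>The points of Z lie in X - B, hence in A, although they were chosen outside A: so Z is empty.\<close>
      have "X - B \<subseteq> A" using q(4) LA[OF qK, of c] q(3) by auto
      moreover have "Z \<subseteq> X - B" using Z(2) B'(3) by (auto simp: U_def)
      ultimately have "A = X" using Z by blast
      have "star_family X A r {q} L"
        unfolding star_family_def using qK L r(1) by (simp add: K_def)
      moreover have "(A - B) \<union> (B - A) \<subseteq> open_star q (L q) c" using q(4) \<open>A = X\<close> BX by blast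
      moreover have "B \<inter> open_star q (L q) (1/2) \<noteq> {}" 
        using q(1) by (intro B'(4)[unfolded \<O>_def]) blast
      then have "B \<inter> open_star q (L q) c \<noteq> {}" using open_star_mono[OF q(2), of q "L q"] by blast
      ultimately show ?thesis
        using r(2) q(2,3) by (intro exI[of _ "{q}"] exI[of _ L] exI[of _ r] exI[of _ c]) simp
    qed
  qed
  ultimately show ?thesis by (intro exI[of _ \<U>] conjI ballI)
qed

theorem theorem4p6:
  fixes X :: "'a::metric_space set"
  assumes "finite_graph X"
  shows "locally_connected_space (subtopology (subcontinua_topology X) (NC_star X))"
  unfolding locally_connected_space_im_kleinen
proof (intro allI impI, elim conjE)
  let ?T = "subtopology (subcontinua_topology X) (NC_star X)"
  have X: "compact X" using assms by (simp add: finite_graph_def continuum_def)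
  interpret M: Metric_space "subcontinua X" hausdorff_dist by (rule Metric_space_subcontinua[OF X])
  fix \<V> A assume "openin ?T \<V>" "A \<in> \<V>"
  then obtain \<W> where \<W>: "openin (subcontinua_topology X) \<W>" "\<V> = \<W> \<inter> NC_star X"
    unfolding openin_subtopology by blast
  then have A: "A \<in> NC_star X" "A \<in> \<W>" using \<open>A \<in> \<V>\<close> by auto
  obtain r where r: "0 < r" "M.mball A r \<subseteq> \<W>"
    using \<W>(1) A(2) unfolding subcontinua_topology_def M.openin_mtopology by blast
  obtain \<U> where \<U>: "openin (subcontinua_topology X) \<U>" "A \<in> \<U>"
    "\<And>B. B \<in> \<U> \<inter> NC_star X \<Longrightarrow> \<exists>P G s c. star_family X A s P G \<and> s \<le> r/3 \<and> 0 < c \<and> c < 1 \<and>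
       (A - B) \<union> (B - A) \<subseteq> (\<Union>p\<in>P. open_star p (G p) c) \<and>
       (\<forall>p\<in>P. B \<inter> open_star p (G p) c \<noteq> {})"
    using NC_star_nearby[OF assms A(1), of "r/3"] r(1) by auto
  let ?U = "\<U> \<inter> \<V>"
  have "openin ?T ?U"
    using openin_Int[OF \<U>(1) \<W>(1)] \<W>(2) unfolding openin_subtopology by (metis Int_assoc)
  moreover have "\<exists>\<C>. connectedin ?T \<C> \<and> \<C> \<subseteq> \<V> \<and> A \<in> \<C> \<and> B \<in> \<C>" if "B \<in> ?U" for B
  proof -
    have B: "B \<in> \<U> \<inter> NC_star X" using that \<W>(2) by blast
    then obtain P G s c where fam: "star_family X A s P G" "s \<le> r/3" "0 < c" "c < 1"
       "(A - B) \<union> (B - A) \<subseteq> (\<Union>p\<in>P. open_star p (G p) c)"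
       "\<And>p. p \<in> P \<Longrightarrow> B \<inter> open_star p (G p) c \<noteq> {}"
      using \<U>(3)[OF B] by blast
    have "2 * s < r" using fam(2) r(1) by simp
    then obtain \<C> where \<C>: "connectedin ?T \<C>" "A \<in> \<C>" "B \<in> \<C>" "\<And>D. D \<in> \<C> \<Longrightarrow> hausdorff_dist A D < r"
      using flow_orbit_connected[OF fam(1) X A(1) _ fam(5,6,3,4)] B by blast
    have sub: "\<C> \<subseteq> NC_star X" using \<C>(1) by (simp add: connectedin_subtopology)
    then have "\<C> \<subseteq> M.mball A r" using \<C>(4) A(1) by (auto simp: NC_star_def)
    then have "\<C> \<subseteq> \<V>" using r(2) \<W>(2) sub by blast
    then show ?thesis using \<C> by blast
  qed
  ultimately show "\<exists>U. openin ?T U \<and> A \<in> U \<and> U \<subseteq> \<V> \<and>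
      (\<forall>B\<in>U. \<exists>\<C>. connectedin ?T \<C> \<and> \<C> \<subseteq> \<V> \<and> A \<in> \<C> \<and> B \<in> \<C>)"
    using \<U>(2) \<open>A \<in> \<V>\<close> by (intro exI[of _ ?U]) blast
qed

end
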